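(* Let $d,L\ge 1$ and let $G=\mathcal{G}_{\le L}(\mathbb{R}^d)$ be the free, step-$L$ nilpotent Lie group over $\mathbb{R}^d$. Let $\nu$ be a probability measure on $G$ that is integrable when considered as a measure on the ambient finite-dimensional linear space $T_{\le L}(\mathbb{R}^d)$. Then the group mean $\mathbf{m}_\nu$ of $\nu$ exists and is unique.
   Context: $T_{\le L}(\mathbb{R}^d)=\bigoplus_{k=0}^{L}(\mathbb{R}^d)^{\otimes k}$ is the truncated tensor algebra, i.e. the real span of the words of length $\le L$ over the letters $1,\dots,d$ with the concatenation product, where products of words of total length $>L$ are set to $0$; its unit is the empty word $\mathsf{e}$, and $[v,w]=vw-wv$. $\mathfrak{g}_{\le L}(\mathbb{R}^d)$ is the smallest sub-Lie algebra of $T_{\le L}(\mathbb{R}^d)$ containing the letters (the free step-$L$ nilpotent Lie algebra), and $\mathcal{G}_{\le L}(\mathbb{R}^d)=\exp(\mathfrak{g}_{\le L}(\mathbb{R}^d))$ with $\exp(z)=\sum_{k\ge0}z^k/k!$, a group under concatenation. The map $\exp:\mathfrak{g}_{\le L}(\mathbb{R}^d)\to\mathcal{G}_{\le L}(\mathbb{R}^d)$ is a global diffeomorphism with inverse $\log(\mathbf{g})=\sum_{k\ge1}\frac{(-1)^{k+1}}{k}(\mathbf{g}-\mathsf{e})^k$. Integrable means that $\int_G \mathbf{x}\,\nu(\mathrm d\mathbf{x})$, computed in the linear space $T_{\le L}(\mathbb{R}^d)$, is (absolutely convergent and) finite. An element $\mathbf{m}_\nu\in G$ is a group mean (barycenter)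 of $\nu$ if $0=\int_G\log(\mathbf{m}_\nu^{-1}\mathbf{x})\,\nu(\mathrm d\mathbf{x})$. *)

theory Defs
  imports "HOL-Analysis.Analysis" "HOL-Probability.Probability_Measure"
begin

text \<open>The step \<open>L\<close> and the number \<open>d\<close> of letters are carried by finite index types:
  \<open>L = CARD('l)\<close>, and the alphabet is \<open>'d\<close> with \<open>d = CARD('d)\<close>. Both are therefore at
  least 1 and otherwise arbitrary. A tensor is stored as its coefficient function on words,
  which vanishes on words longer than \<open>L\<close>.\<close>

typedef ('d, 'l) tensor = "{x :: 'd list \<Rightarrow> real. \<forall>w. CARD('l) < length w \<longrightarrow> x w = 0}"
  morphisms coeff Abs_tensor
  by (rule exI[of _ "\<lambda>_. 0"]) simp

setup_lifting type_definition_tensor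

lemma tensor_eqI: "(\<And>w. coeff x w = coeff y w) \<Longrightarrow> x = y"
  by (simp add: coeff_inject[symmetric] fun_eq_iff)

lemma coeff_long: "CARD('l) < length w \<Longrightarrow> coeff (x :: ('d, 'l) tensor) w = 0"
  using coeff[of x] by simp

lift_definition tensor_of_word :: "'d list \<Rightarrow> ('d, 'l) tensor"
  is "\<lambda>v w. if w = v \<and> length w \<le> CARD('l) then 1 else 0"
  by auto

definition letter :: "'d \<Rightarrow> ('d, 'l) tensor"
  where "letter i = tensor_of_word [i]"

instantiation tensor :: (type, type) real_vector
begin

lift_definition zero_tensor :: "('a, 'b) tensor" is "\<lambda>_. 0" by simp
lift_definition plus_tensor :: "('a, 'b) tensor \<Rightarrow> ('a, 'b) tensor \<Rightarrow> ('a, 'b) tensor"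
  is "\<lambda>x y w. x w + y w" by simp
lift_definition minus_tensor :: "('a, 'b) tensor \<Rightarrow> ('a, 'b) tensor \<Rightarrow> ('a, 'b) tensor"
  is "\<lambda>x y w. x w - y w" by simp
lift_definition uminus_tensor :: "('a, 'b) tensor \<Rightarrow> ('a, 'b) tensor"
  is "\<lambda>x w. - x w" by simp
lift_definition scaleR_tensor :: "real \<Rightarrow> ('a, 'b) tensor \<Rightarrow> ('a, 'b) tensor"
  is "\<lambda>r x w. r * x w" by simp

instance
  by standard (transfer; simp add: fun_eq_iff algebra_simps)+

end

text \<open>The coefficient of \<open>w\<close> in a product collects all factorisations
  \<open>w = take i w @ drop i w\<close>; words longer than \<open>L\<close> are cut off.\<close>

instantiation tensor :: (type, finite) real_algebra_1
begin

lift_definition one_tensor :: "('a, 'b) tensor" is "\<lambda>w. if w = [] then 1 else 0" by auto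
lift_definition times_tensor :: "('a, 'b) tensor \<Rightarrow> ('a, 'b) tensor \<Rightarrow> ('a, 'b) tensor"
  is "\<lambda>x y w. if length w \<le> CARD('b) then \<Sum>i\<le>length w. x (take i w) * y (drop i w) else 0"
  by auto

instance
proof
  fix a b c :: "('a, 'b) tensor" and r :: real
  show "a * b * c = a * (b * c)"
  proof (rule tensor_eqI)
    fix w :: "'a list"
    show "coeff (a * b * c) w = coeff (a * (b * c)) w"
    proof (cases "length w \<le> CARD('b)")
      case True
      let ?n = "length w"
      let ?t = "\<lambda>j k. coeff a (take j w) * coeff b (take k (drop j w)) * coeff c (drop (j + k) w)"
      have "coeff (a * b * c) w
          = (\<Sum>i\<le>?n. \<Sum>j\<le>i. ?t j (i - j))"
        using True
        by (auto simp: times_tensor.rep_eq sum_distrib_right min_absorb2 drop_take min_def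
            intro!: sum.cong)
      also have "\<dots> = (\<Sum>j\<le>?n. \<Sum>k\<le>?n - j. ?t j k)"
        by (simp add: sum.triangle_reindex_eq[symmetric] sum.Sigma)
          (rule sum.reindex_bij_witness[of _ "\<lambda>(j, k). (j + k, j)" "\<lambda>(i, j). (j, i - j)"]; force)
      also have "\<dots> = coeff (a * (b * c)) w"
        using True
        by (auto simp: times_tensor.rep_eq sum_distrib_left mult.assoc add.commute
            intro!: sum.cong)
      finally show ?thesis .
    qed (simp add: times_tensor.rep_eq)
  qed
  show "1 * a = a"
  proof (rule tensor_eqI)
    fix w
    have "(\<Sum>i\<le>length w. (if take i w = [] then 1 else 0) * coeff a (drop i w))
        = (\<Sum>i\<in>{0}. coeff a (drop i w))"
      by (rule sum.mono_neutral_cong_right) auto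
    then show "coeff (1 * a) w = coeff a w"
      by (simp add: times_tensor.rep_eq one_tensor.rep_eq coeff_long)
  qed
  show "a * 1 = a"
  proof (rule tensor_eqI)
    fix w
    have "(\<Sum>i\<le>length w. coeff a (take i w) * (if drop i w = [] then 1 else 0))
        = (\<Sum>i\<in>{length w}. coeff a (take i w))"
      by (rule sum.mono_neutral_cong_right) auto
    then show "coeff (a * 1) w = coeff a w"
      by (simp add: times_tensor.rep_eq one_tensor.rep_eq coeff_long)
  qed
  show "(a + b) * c = a * c + b * c" "a * (b + c) = a * b + a * c"
    "r *\<^sub>R a * b = r *\<^sub>R (a * b)" "a * r *\<^sub>R b = r *\<^sub>R (a * b)"
    by (auto simp: times_tensor.rep_eq plus_tensor.rep_eq scaleR_tensor.rep_eq
        sum.distrib sum_distrib_left algebra_simps intro!: tensor_eqI)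
  show "(0 :: ('a, 'b) tensor) \<noteq> 1"
    by transfer (auto simp: fun_eq_iff)
qed

end

lemma finite_short_words: "finite {w :: 'd::finite list. length w \<le> n}"
  using finite_lists_length_le[of "UNIV :: 'd set" n] by simp

text \<open>The space carries its usual finite-dimensional topology, given here by the inner product for
  which the words of length at most \<open>L\<close> are an orthonormal basis.\<close>

instantiation tensor :: (finite, finite) euclidean_space
begin

definition inner_tensor :: "('a, 'b) tensor \<Rightarrow> ('a, 'b) tensor \<Rightarrow> real"
  where "inner x y = (\<Sum>w | length w \<le> CARD('b). coeff x w * coeff y w)"
definition norm_tensor :: "('a, 'b) tensor \<Rightarrow> real"
  where "norm_tensor x = sqrt (inner x x)"
definition sgn_tensor :: "('a, 'b) tensor \<Rightarrow> ('a, 'b) tensor"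
  where "sgn_tensor x = x /\<^sub>R norm x"
definition dist_tensor :: "('a, 'b) tensor \<Rightarrow> ('a, 'b) tensor \<Rightarrow> real"
  where "dist_tensor x y = norm (x - y)"
definition uniformity_tensor :: "(('a, 'b) tensor \<times> ('a, 'b) tensor) filter"
  where "uniformity_tensor = (INF e\<in>{0 <..}. principal {(x, y). dist x y < e})"
definition open_tensor :: "('a, 'b) tensor set \<Rightarrow> bool"
  where "open_tensor U \<longleftrightarrow> (\<forall>x\<in>U. \<forall>\<^sub>F (x', y) in uniformity. x' = x \<longrightarrow> y \<in> U)"
definition Basis_tensor :: "('a, 'b) tensor set"
  where "Basis_tensor = tensor_of_word ` {w. length w \<le> CARD('b)}"

instance
proof
  fix x y z :: "('a, 'b) tensor" and r :: real and U :: "('a, 'b) tensor set"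
  let ?W = "{w :: 'a list. length w \<le> CARD('b)}"
  have fin: "finite ?W" by (rule finite_short_words)
  show "norm x = sqrt (inner x x)" by (rule norm_tensor_def)
  show "sgn x = x /\<^sub>R norm x" by (rule sgn_tensor_def)
  show "dist x y = norm (x - y)" by (rule dist_tensor_def)
  show "uniformity = (INF e\<in>{0 <..}. principal {(x :: ('a, 'b) tensor, y). dist x y < e})"
    by (rule uniformity_tensor_def)
  show "open U \<longleftrightarrow> (\<forall>x\<in>U. \<forall>\<^sub>F (x', y) in uniformity. x' = x \<longrightarrow> y \<in> U)"
    by (rule open_tensor_def)
  show "inner x y = inner y x"
    by (simp add: inner_tensor_def mult.commute)
  show "inner (x + y) z = inner x z + inner y z"
    by (simp add: inner_tensor_def plus_tensor.rep_eq sum.distrib algebra_simps)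
  show "inner (r *\<^sub>R x) y = r * inner x y"
    by (simp add: inner_tensor_def scaleR_tensor.rep_eq sum_distrib_left mult.assoc)
  show "0 \<le> inner x x"
    by (simp add: inner_tensor_def sum_nonneg)
  have zero_iff: "x = 0 \<longleftrightarrow> (\<forall>w\<in>?W. coeff x w = 0)" for x :: "('a, 'b) tensor"
  proof
    assume "\<forall>w\<in>?W. coeff x w = 0"
    then show "x = 0"
      by (intro tensor_eqI) (metis coeff_long mem_Collect_eq not_le zero_tensor.rep_eq)
  qed (simp add: zero_tensor.rep_eq)
  show "inner x x = 0 \<longleftrightarrow> x = 0"
    unfolding zero_iff by (simp add: inner_tensor_def sum_nonneg_eq_0_iff[OF fin])
  have inner_word: "inner x (tensor_of_word w) = coeff x w"
    if "w \<in> ?W" for w and x :: "('a, 'b) tensor"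
  proof -
    have "inner x (tensor_of_word w) = (\<Sum>v\<in>{w}. coeff x v)"
      unfolding inner_tensor_def
      by (rule sum.mono_neutral_cong_right) (use fin that in \<open>auto simp: tensor_of_word.rep_eq\<close>)
    then show ?thesis by simp
  qed
  show "(Basis :: ('a, 'b) tensor set) \<noteq> {}"
    unfolding Basis_tensor_def by (auto intro: exI[of _ "[]"])
  show "finite (Basis :: ('a, 'b) tensor set)"
    unfolding Basis_tensor_def using fin by simp
  show "inner u v = (if u = v then 1 else 0)"
    if "u \<in> Basis" "v \<in> Basis" for u v :: "('a, 'b) tensor"
  proof -
    from that obtain a b where "u = tensor_of_word a" "v = tensor_of_word b" "a \<in> ?W" "b \<in> ?W"
      unfolding Basis_tensor_def by auto
    moreover from this have "u = v \<longleftrightarrow> a = b"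
      by (metis (mono_tags) mem_Collect_eq tensor_of_word.rep_eq zero_neq_one)
    ultimately show ?thesis
      by (simp add: inner_word tensor_of_word.rep_eq)
  qed
  show "(\<forall>u\<in>Basis. inner x u = 0) \<longleftrightarrow> x = 0"
    unfolding zero_iff Basis_tensor_def by (simp add: inner_word)
qed

end

definition lie_bracket :: "('d, 'l::finite) tensor \<Rightarrow> ('d, 'l) tensor \<Rightarrow> ('d, 'l) tensor"
  where "lie_bracket v w = v * w - w * v"

definition lie_subalgebra :: "('d, 'l::finite) tensor set \<Rightarrow> bool"
  where "lie_subalgebra S \<longleftrightarrow> subspace S \<and> (\<forall>v\<in>S. \<forall>w\<in>S. lie_bracket v w \<in> S)"

definition free_nilpotent_lie_algebra :: "('d, 'l::finite) tensor set"
  where "free_nilpotent_lie_algebra = lie_subalgebra hull (range letter)"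

text \<open>The library exponential is not available: it needs a submultiplicative norm, which the
  Euclidean norm above is not.\<close>

definition tensor_exp :: "('d::finite, 'l::finite) tensor \<Rightarrow> ('d, 'l) tensor"
  where "tensor_exp z = (\<Sum>k. z ^ k /\<^sub>R fact k)"

text \<open>The usual logarithm series, with its summation index starting at 0 instead of 1.\<close>

definition tensor_log :: "('d::finite, 'l::finite) tensor \<Rightarrow> ('d, 'l) tensor"
  where "tensor_log g = (\<Sum>k. ((-1) ^ k / real (Suc k)) *\<^sub>R (g - 1) ^ Suc k)"

definition free_nilpotent_group :: "('d::finite, 'l::finite) tensor set"
  where "free_nilpotent_group = tensor_exp ` free_nilpotent_lie_algebra"

definition group_inverse :: "('d::finite, 'l::finite) tensor \<Rightarrow> ('d, 'l) tensor"
  where "group_inverse g = (THE h. h \<in> free_nilpotent_group \<and> g * h = 1 \<and> h * g = 1)"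

text \<open>Convergence of the integral is part of being a group mean; the Bochner integral
  of a non-integrable function is 0 by convention, so an equation would not express it.\<close>

definition is_group_mean :: "('d::finite, 'l::finite) tensor measure \<Rightarrow> ('d, 'l) tensor \<Rightarrow> bool"
  where "is_group_mean \<nu> m \<longleftrightarrow> m \<in> free_nilpotent_group \<and>
    has_bochner_integral \<nu> (\<lambda>x. tensor_log (group_inverse m * x)) 0"

end

theory Submission
  imports Defs "HOL-Computational_Algebra.Formal_Power_Series"
begin

text \<open>
  Let \<open>G\<close> be the group, \<open>\<gg>\<close> its Lie algebra and \<open>E = \<integral> x d\<nu>\<close> the ordinary mean, which lies in the ambient
  algebra but in general not in \<open>G\<close>. The key point is that the logarithm, a polynomial of degree \<open>L\<close> on
  the ambient algebra, agrees on \<open>G\<close> with a \<^emph>\<open>linear\<close> map \<open>\<pi>\<close> (\<open>log_extends_linearly\<close>). Hence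
  \<open>log (h * x) = \<pi> (h * x)\<close> is integrable over \<open>x\<close> as soon as \<open>x\<close> is, and for
  \<open>m = exp (- z)\<close> with \<open>z \<in> \<gg>\<close> the mean equation becomes the algebraic equation
  \<open>\<pi> (exp z * E) = 0\<close>. The constant coefficient of \<open>E\<close> is 1; therefore, if \<open>z\<close> and \<open>z'\<close>
  agree on words shorter than \<open>k\<close>, then \<open>\<pi> (exp z * E) - \<pi> (exp z' * E)\<close> agrees with
  \<open>z - z'\<close> on words of length up to \<open>k\<close>. Thus
  \<open>z \<mapsto> z - \<pi> (exp z * E)\<close> is a contraction for the filtration by word length, it maps \<open>\<gg>\<close> to
  itself because \<open>\<pi> (exp z * E)\<close> is an average of logarithms of group elements, and
  a contraction has exactly one fixed point in \<open>\<gg>\<close> since the filtration is finite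
  (\<open>filtration_contraction_unique_fixpoint\<close>).

  Two facts about \<open>G\<close> enter, and both are read off the degree derivation \<open>Y\<close>, which multiplies the
  coefficient of \<open>w\<close> by \<open>length w\<close>. For \<open>c \<in> \<gg>\<close> the classical formula for the derivative of the
  exponential gives \<open>Y (exp c) = exp c * l\<close> with \<open>l \<in> \<gg>\<close>, and this equation determines \<open>exp c\<close> by
  recursion on the word length.

  First, \<open>G\<close> is closed under products (\<open>free_nilpotent_group_mult\<close>). If \<open>Y g = g * l\<close> and
  \<open>Y h = h * l'\<close>, then \<open>Y (g * h) = g * h * (h\<^sup>-\<^sup>1 * l * h + l')\<close>, and the bracketed element
  belongs to \<open>\<gg>\<close>. Each \<open>l \<in> \<gg>\<close> arises from some \<open>exp c\<close> with \<open>c \<in> \<gg>\<close>, again by the fixed-point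
  lemma, so \<open>g * h\<close> is such an exponential. This replaces the Baker-Campbell-Hausdorff series.

  Second, coefficients of group elements multiply by the shuffle rule (\<open>exp_group_like\<close>). Elements of
  \<open>\<gg>\<close> vanish on shuffles of two nonempty words, and \<open>Y g = g * l\<close> carries this over to \<open>g\<close> by
  induction on the total length. As a consequence every product of coefficients that occurs in the
  logarithm series is, on \<open>G\<close>, a linear combination of coefficients; this yields \<open>\<pi>\<close>.
\<close>

section \<open>The filtration by word length\<close>

definition vanishes_below :: "nat \<Rightarrow> ('d, 'l) tensor \<Rightarrow> bool"
  where "vanishes_below n x \<longleftrightarrow> (\<forall>w. length w < n \<longrightarrow> coeff x w = 0)"

lemma vanishes_below_0 [simp]: "vanishes_below 0 x"
  by (simp add: vanishes_below_def)

lemma vanishes_below_zero [simp]: "vanishes_below n 0"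
  by (simp add: vanishes_below_def zero_tensor.rep_eq)

lemma vanishes_below_mono: "vanishes_below n x \<Longrightarrow> m \<le> n \<Longrightarrow> vanishes_below m x"
  by (simp add: vanishes_below_def)

lemma vanishes_below_add: "vanishes_below n x \<Longrightarrow> vanishes_below n y \<Longrightarrow> vanishes_below n (x + y)"
  by (simp add: vanishes_below_def plus_tensor.rep_eq)

lemma vanishes_below_diff: "vanishes_below n x \<Longrightarrow> vanishes_below n y \<Longrightarrow> vanishes_below n (x - y)"
  by (simp add: vanishes_below_def minus_tensor.rep_eq)

lemma vanishes_below_scaleR: "vanishes_below n x \<Longrightarrow> vanishes_below n (r *\<^sub>R x)"
  by (simp add: vanishes_below_def scaleR_tensor.rep_eq)

lemma vanishes_below_sum: "(\<And>i. i \<in> I \<Longrightarrow> vanishes_below n (f i)) \<Longrightarrow> vanishes_below n (sum f I)"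
  by (induction I rule: infinite_finite_induct) (auto intro: vanishes_below_add)

lemma vanishes_below_imp_zero:
  "vanishes_below n (x :: ('d, 'l) tensor) \<Longrightarrow> CARD('l) < n \<Longrightarrow> x = 0"
  by (rule tensor_eqI) (metis coeff_long linorder_le_less_linear order_le_less_trans
      vanishes_below_def zero_tensor.rep_eq)

lemma vanishes_below_mult:
  fixes x y :: "('d, 'l::finite) tensor"
  assumes "vanishes_below m x" "vanishes_below n y"
  shows "vanishes_below (m + n) (x * y)"
  unfolding vanishes_below_def times_tensor.rep_eq
proof (intro allI impI)
  fix w :: "'d list"
  assume w: "length w < m + n"
  have "coeff x (take i w) * coeff y (drop i w) = 0" if "i \<le> length w" for i
  proof (cases "i < m")
    case False
    with w that have "length (drop i w) < n" by simp
    with assms(2) show ?thesis by (simp add: vanishes_below_def)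
  qed (use assms(1) that in \<open>auto simp: vanishes_below_def\<close>)
  then show "(if length w \<le> CARD('l)
      then \<Sum>i\<le>length w. coeff x (take i w) * coeff y (drop i w) else 0) = 0"
    by (auto intro!: sum.neutral)
qed

lemma vanishes_below_power:
  "vanishes_below 1 (z :: ('d, 'l::finite) tensor) \<Longrightarrow> vanishes_below n (z ^ n)"
  by (induction n) (auto dest: vanishes_below_mult[of 1 z, simplified])

lemma power_above_step_eq_0: "vanishes_below 1 (z :: ('d, 'l::finite) tensor) \<Longrightarrow> CARD('l) < n \<Longrightarrow> z ^ n = 0"
  using vanishes_below_power vanishes_below_imp_zero by blast

lemma vanishes_below_power_diff:
  fixes z z' :: "('d, 'l::finite) tensor"
  assumes "vanishes_below k (z - z')"
  shows "vanishes_below k (z ^ n - z' ^ n)"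
proof (induction n)
  case (Suc n)
  have "z ^ Suc n - z' ^ Suc n = z * (z ^ n - z' ^ n) + (z - z') * z' ^ n"
    by (simp add: algebra_simps)
  moreover have "vanishes_below k (z * (z ^ n - z' ^ n))" "vanishes_below k ((z - z') * z' ^ n)"
    using vanishes_below_mult[OF vanishes_below_0 Suc] vanishes_below_mult[OF assms vanishes_below_0]
    by simp_all
  ultimately show ?case by (simp only: vanishes_below_add)
qed simp

text \<open>The finite-filtration analogue of Banach's theorem: each application of \<open>F\<close> gains one degree of
  agreement, and tensors that agree up to degree \<open>L\<close> are equal, so the iterates become stationary.
  It solves equations in \<open>\<gg>\<close> degree by degree without splitting tensors into
  homogeneous parts.\<close>

lemma filtration_contraction_unique_fixpoint:
  fixes F :: "('d, 'l::finite) tensor \<Rightarrow> ('d, 'l) tensor"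
  assumes ne: "a \<in> S" and F: "\<And>z. z \<in> S \<Longrightarrow> F z \<in> S"
    and contr: "\<And>k z z'. z \<in> S \<Longrightarrow> z' \<in> S \<Longrightarrow> vanishes_below k (z - z')
      \<Longrightarrow> vanishes_below (Suc k) (F z - F z')"
  shows "\<exists>!z. z \<in> S \<and> F z = z"
proof -
  let ?n = "Suc CARD('l)"
  have in_S: "(F ^^ k) a \<in> S" for k
    by (induction k) (use ne F in auto)
  have "vanishes_below k (F ((F ^^ k) a) - (F ^^ k) a)" for k
  proof (induction k)
    case (Suc k)
    then show ?case using contr[OF F[OF in_S] in_S Suc] by simp
  qed simp
  from vanishes_below_imp_zero[OF this[of ?n]]
  have "F ((F ^^ ?n) a) = (F ^^ ?n) a" by simp
  moreover have "z = z'" if "z \<in> S" "F z = z" "z' \<in> S" "F z' = z'" for z z'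
  proof -
    have "vanishes_below k (z - z')" for k
    proof (induction k)
      case (Suc k)
      then show ?case using contr[OF that(1,3) Suc] that by simp
    qed simp
    from vanishes_below_imp_zero[OF this[of ?n]] show ?thesis by simp
  qed
  ultimately show ?thesis using in_S by blast
qed

section \<open>Power series evaluated at nilpotent tensors\<close>

text \<open>On tensors without constant coefficient this is the evaluation of a formal power series, whose
  terms beyond degree \<open>L\<close> vanish. There it is a ring homomorphism compatible with composition, so
  that identities between \<open>exp\<close> and \<open>log\<close> transfer from formal power series.\<close>

definition power_series_at :: "real fps \<Rightarrow> ('d, 'l::finite) tensor \<Rightarrow> ('d, 'l) tensor"
  where "power_series_at f z = (\<Sum>n\<le>CARD('l). fps_nth f n *\<^sub>R z ^ n)"

text \<open>The terms that the triangle misses from the square have total degree above \<open>L\<close>.\<close>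

lemma sum_Cauchy_product_filtered:
  fixes a b :: "nat \<Rightarrow> ('d, 'l::finite) tensor"
  assumes "\<And>n. vanishes_below n (a n)" "\<And>n. vanishes_below n (b n)"
  shows "(\<Sum>n\<le>CARD('l). \<Sum>k\<le>n. a (n - k) * b k) = (\<Sum>n\<le>CARD('l). a n) * (\<Sum>k\<le>CARD('l). b k)"
proof -
  let ?L = "CARD('l)"
  have "(\<Sum>n\<le>?L. \<Sum>k\<le>n. a (n - k) * b k) = (\<Sum>(i, j)\<in>{(i, j). i + j \<le> ?L}. a i * b j)"
    unfolding sum.Sigma[OF finite_atMost ballI[OF finite_atMost]]
    by (rule sum.reindex_bij_witness[of _ "\<lambda>(i, j). (i + j, j)" "\<lambda>(n, k). (n - k, k)"]) auto
  also have "\<dots> = (\<Sum>(i, j)\<in>{..?L} \<times> {..?L}. a i * b j)"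
  proof (rule sum.mono_neutral_left)
    show "\<forall>p\<in>{..?L} \<times> {..?L} - {(i, j). i + j \<le> ?L}. (case p of (i, j) \<Rightarrow> a i * b j) = 0"
      using vanishes_below_imp_zero[OF vanishes_below_mult[OF assms]]
      by (clarsimp, metis not_le)
  qed auto
  also have "\<dots> = (\<Sum>n\<le>?L. a n) * (\<Sum>k\<le>?L. b k)"
    by (simp add: sum_product sum.cartesian_product)
  finally show ?thesis .
qed

lemma fps_mult_nth_rev: "fps_nth (f * g) n = (\<Sum>k\<le>n. fps_nth f (n - k) * fps_nth (g :: real fps) k)"
  unfolding mult.commute[of f g] fps_mult_nth atLeast0AtMost by (simp add: mult.commute)

lemma power_series_at_mult:
  fixes z :: "('d, 'l::finite) tensor"
  assumes "vanishes_below 1 z"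
  shows "power_series_at (f * g) z = power_series_at f z * power_series_at g z"
proof -
  have *: "vanishes_below n (fps_nth h n *\<^sub>R z ^ n)" for n h
    by (intro vanishes_below_scaleR vanishes_below_power assms)
  have "power_series_at (f * g) z
      = (\<Sum>n\<le>CARD('l). \<Sum>k\<le>n. fps_nth f (n - k) *\<^sub>R z ^ (n - k) * fps_nth g k *\<^sub>R z ^ k)"
    unfolding power_series_at_def
    unfolding fps_mult_nth_rev scaleR_sum_left
    by (intro sum.cong refl) (simp add: mult.commute flip: power_add)
  then show ?thesis
    using sum_Cauchy_product_filtered[OF * *] by (simp add: power_series_at_def)
qed

lemma power_series_at_1 [simp]: "power_series_at 1 z = 1"
proof -
  have "power_series_at 1 z = (\<Sum>n\<in>{0}. z ^ n)"
    unfolding power_series_at_def by (rule sum.mono_neutral_cong_right) auto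
  then show ?thesis by simp
qed

lemma power_series_at_X [simp]:
  "power_series_at fps_X (z :: ('d, 'l::finite) tensor) = z"
proof -
  have "power_series_at fps_X z = (\<Sum>n\<in>{1}. z ^ n)"
    unfolding power_series_at_def by (rule sum.mono_neutral_cong_right) (auto simp: Suc_le_eq)
  then show ?thesis by simp
qed

lemma power_series_at_power:
  "vanishes_below 1 z \<Longrightarrow> power_series_at (f ^ n) z = power_series_at f z ^ n"
  by (induction n) (simp_all add: power_series_at_mult)

lemma power_series_at_compose:
  fixes z :: "('d, 'l::finite) tensor"
  assumes "vanishes_below 1 z" "fps_nth g 0 = 0"
  shows "power_series_at (f oo g) z = power_series_at f (power_series_at g z)"
proof -
  have "power_series_at (f oo g) z
      = (\<Sum>n\<le>CARD('l). \<Sum>i\<le>CARD('l). fps_nth f i *\<^sub>R fps_nth (g ^ i) n *\<^sub>R z ^ n)"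
    unfolding power_series_at_def fps_compose_nth scaleR_sum_left
  proof (rule sum.cong[OF refl])
    fix n assume "n \<in> {..CARD('l)}"
    then show "(\<Sum>i = 0..n. (fps_nth f i * fps_nth (g ^ i) n) *\<^sub>R z ^ n)
        = (\<Sum>i\<le>CARD('l). fps_nth f i *\<^sub>R fps_nth (g ^ i) n *\<^sub>R z ^ n)"
      by (intro sum.mono_neutral_cong_left)
        (auto simp: startsby_zero_power_prefix[OF assms(2)])
  qed
  also have "\<dots> = (\<Sum>i\<le>CARD('l). fps_nth f i *\<^sub>R power_series_at (g ^ i) z)"
    by (subst sum.swap) (simp add: power_series_at_def scaleR_sum_right)
  also have "\<dots> = power_series_at f (power_series_at g z)"
    by (simp add: power_series_at_power[OF assms(1)]) (simp add: power_series_at_def)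
  finally show ?thesis .
qed

lemma tensor_exp_eq_sum:
  fixes z :: "('d::finite, 'l::finite) tensor"
  assumes "vanishes_below 1 z"
  shows "tensor_exp z = (\<Sum>n\<le>CARD('l). z ^ n /\<^sub>R fact n)"
  unfolding tensor_exp_def by (rule suminf_finite) (auto simp: power_above_step_eq_0[OF assms])

lemma tensor_exp_eq_power_series:
  fixes z :: "('d::finite, 'l::finite) tensor"
  assumes "vanishes_below 1 z"
  shows "tensor_exp z = power_series_at (fps_exp 1) z"
  unfolding tensor_exp_eq_sum[OF assms] power_series_at_def by (simp add: divide_inverse)

lemma tensor_log_eq_power_series:
  fixes g :: "('d::finite, 'l::finite) tensor"
  assumes "vanishes_below 1 (g - 1)"
  shows "tensor_log g = power_series_at (fps_ln 1) (g - 1)"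
proof -
  have "tensor_log g = (\<Sum>k<CARD('l). ((-1) ^ k / real (Suc k)) *\<^sub>R (g - 1) ^ Suc k)"
    unfolding tensor_log_def by (rule suminf_finite) (auto simp: power_above_step_eq_0[OF assms] simp del: power_Suc)
  also have "\<dots> = (\<Sum>n\<in>{1..CARD('l)}. fps_nth (fps_ln 1) n *\<^sub>R (g - 1) ^ n)"
    by (rule sum.reindex_bij_witness[of _ "\<lambda>n. n - 1" Suc])
      (auto simp: fps_ln_nth simp del: power_Suc)
  also have "\<dots> = power_series_at (fps_ln 1) (g - 1)"
    unfolding power_series_at_def by (rule sum.mono_neutral_left) (auto simp: fps_ln_nth)
  finally show ?thesis .
qed

lemma vanishes_below_uminus: "vanishes_below n z \<Longrightarrow> vanishes_below n (- z)"
  by (simp add: vanishes_below_def uminus_tensor.rep_eq)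

lemma power_minus_tensor: "(- z) ^ n = (-1 :: real) ^ n *\<^sub>R (z :: ('d, 'l::finite) tensor) ^ n"
  by (induction n) simp_all

lemma tensor_exp_uminus_mult:
  fixes z :: "('d::finite, 'l::finite) tensor"
  assumes "vanishes_below 1 z"
  shows "tensor_exp z * tensor_exp (- z) = 1"
proof -
  have "tensor_exp (- z) = power_series_at (fps_exp (- 1)) z"
    unfolding tensor_exp_eq_sum[OF vanishes_below_uminus[OF assms]] power_series_at_def
    by (intro sum.cong refl) (simp add: power_minus_tensor[of z] divide_inverse)
  then show ?thesis
    using assms by (simp add: tensor_exp_eq_power_series power_series_at_mult[symmetric]
        fps_exp_add_mult[symmetric])
qed

lemma tensor_exp_uminus_mult_left:
  fixes z :: "('d::finite, 'l::finite) tensor"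
  assumes "vanishes_below 1 z"
  shows "tensor_exp (- z) * tensor_exp z = 1"
  using tensor_exp_uminus_mult[OF vanishes_below_uminus[OF assms]] by simp

lemma power_series_at_diff: "power_series_at (f - g) z = power_series_at f z - power_series_at g z"
  by (simp add: power_series_at_def scaleR_left_diff_distrib sum_subtractf)

lemma vanishes_below_tensor_exp:
  fixes z :: "('d::finite, 'l::finite) tensor"
  assumes "vanishes_below 1 z"
  shows "vanishes_below 1 (tensor_exp z - 1)"
proof -
  have "tensor_exp z - 1 = power_series_at (fps_exp 1 - 1) z"
    by (simp add: tensor_exp_eq_power_series[OF assms] power_series_at_diff)
  moreover have "vanishes_below 1 (fps_nth (fps_exp 1 - 1) n *\<^sub>R z ^ n)" for n
    by (cases n) (auto intro!: vanishes_below_scaleR simp del: power_Suc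
        intro: vanishes_below_mono[OF vanishes_below_power[OF assms]])
  ultimately show ?thesis
    by (simp only: power_series_at_def vanishes_below_sum)
qed

lemma tensor_log_exp:
  fixes z :: "('d::finite, 'l::finite) tensor"
  assumes "vanishes_below 1 z"
  shows "tensor_log (tensor_exp z) = z"
proof -
  have "tensor_log (tensor_exp z) = power_series_at (fps_ln 1) (power_series_at (fps_exp 1 - 1) z)"
    using vanishes_below_tensor_exp[OF assms]
    by (simp add: tensor_log_eq_power_series power_series_at_diff tensor_exp_eq_power_series[OF assms] del: One_nat_def)
  also have "\<dots> = power_series_at (fps_ln 1 oo (fps_exp 1 - 1)) z"
    by (rule power_series_at_compose[symmetric]) (use assms in auto)
  also have "fps_ln (1::real) oo (fps_exp 1 - 1) = fps_X"
    unfolding fps_ln_fps_exp_inv[of "1::real", simplified] by (rule fps_inv) auto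
  finally show ?thesis by simp
qed

section \<open>The free nilpotent Lie algebra\<close>

abbreviation "\<gg> \<equiv> free_nilpotent_lie_algebra"

lemma lie_subalgebra_free_lie: "lie_subalgebra \<gg>"
  unfolding free_nilpotent_lie_algebra_def
proof (rule hull_in)
  fix T :: "('a, 'b::finite) tensor set set"
  assume "Ball T lie_subalgebra"
  then show "lie_subalgebra (\<Inter> T)"
    by (auto simp: lie_subalgebra_def intro!: subspace_Inter)
qed

lemma subspace_free_lie: "subspace \<gg>"
  and lie_bracket_free_lie: "v \<in> \<gg> \<Longrightarrow> w \<in> \<gg> \<Longrightarrow> lie_bracket v w \<in> \<gg>"
  using lie_subalgebra_free_lie by (auto simp: lie_subalgebra_def)

lemma letter_free_lie: "letter i \<in> \<gg>"
  unfolding free_nilpotent_lie_algebra_def by (auto intro: hull_inc)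

lemma free_lie_minimal: "lie_subalgebra S \<Longrightarrow> (\<And>i. letter i \<in> S) \<Longrightarrow> \<gg> \<subseteq> S"
  unfolding free_nilpotent_lie_algebra_def by (rule hull_minimal) auto

lemma free_lie_vanishes_below:
  assumes "z \<in> \<gg>" shows "vanishes_below 1 (z :: ('d, 'l::finite) tensor)"
proof -
  have "\<gg> \<subseteq> {x :: ('d, 'l) tensor. vanishes_below 1 x}"
  proof (rule free_lie_minimal)
    show "lie_subalgebra {x :: ('d, 'l) tensor. vanishes_below 1 x}"
      by (auto simp: lie_subalgebra_def subspace_def lie_bracket_def simp del: One_nat_def
          intro!: vanishes_below_add vanishes_below_scaleR vanishes_below_diff
          intro: vanishes_below_mono[OF vanishes_below_mult])
  qed (auto simp: vanishes_below_def letter_def tensor_of_word.rep_eq)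
  then show ?thesis using assms by auto
qed

lemma ad_power_free_lie: "c \<in> \<gg> \<Longrightarrow> y \<in> \<gg> \<Longrightarrow> (lie_bracket c ^^ k) y \<in> \<gg>"
  by (induction k) (auto intro: lie_bracket_free_lie)

lemma vanishes_below_lie_bracket:
  "vanishes_below m x \<Longrightarrow> vanishes_below n y \<Longrightarrow> vanishes_below (m + n) (lie_bracket x y)"
  unfolding lie_bracket_def
  using vanishes_below_mult[of m x n y] vanishes_below_mult[of n y m x]
  by (simp add: vanishes_below_diff add.commute)

lemma vanishes_below_ad_power:
  assumes "vanishes_below 1 c" "vanishes_below n y"
  shows "vanishes_below (n + k) ((lie_bracket c ^^ k) y)"
proof (induction k)
  case (Suc k)
  then show ?case using vanishes_below_lie_bracket[OF assms(1) Suc] by simp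
qed (use assms in simp)

lemma lie_bracket_diff: "lie_bracket c a - lie_bracket c' a' = lie_bracket c (a - a') + lie_bracket (c - c') a'"
  by (simp add: lie_bracket_def algebra_simps)

lemma vanishes_below_ad_power_diff:
  assumes c: "vanishes_below 1 c" "vanishes_below 1 c'" "vanishes_below j (c - c')"
    and y: "vanishes_below 1 y'" "vanishes_below j (y - y')"
  shows "vanishes_below (j + k) ((lie_bracket c ^^ k) y - (lie_bracket c' ^^ k) y')"
proof (induction k)
  case (Suc k)
  have "vanishes_below (j + Suc k) (lie_bracket c ((lie_bracket c ^^ k) y - (lie_bracket c' ^^ k) y'))"
    using vanishes_below_lie_bracket[OF c(1) Suc] by simp
  moreover have "vanishes_below (j + Suc k) (lie_bracket (c - c') ((lie_bracket c' ^^ k) y'))"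
    using vanishes_below_lie_bracket[OF c(3) vanishes_below_ad_power[OF c(2) y(1)]] by simp
  ultimately show ?case by (simp add: lie_bracket_diff vanishes_below_add)
qed (use y in simp)

section \<open>Moving an element past powers\<close>

lemma sum_Pascal:
  fixes t :: "nat \<Rightarrow> 'a::real_vector"
  shows "(\<Sum>k\<le>Suc n. real (Suc n choose k) *\<^sub>R t k)
    = (\<Sum>k\<le>n. real (n choose k) *\<^sub>R t k) + (\<Sum>k\<le>n. real (n choose k) *\<^sub>R t (Suc k))"
proof -
  have "(\<Sum>k\<le>Suc n. real (Suc n choose k) *\<^sub>R t k)
      = (t 0 + (\<Sum>k\<le>n. real (n choose Suc k) *\<^sub>R t (Suc k))) + (\<Sum>k\<le>n. real (n choose k) *\<^sub>R t (Suc k))"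
    by (simp add: sum.atMost_Suc_shift scaleR_add_left sum.distrib del: sum.atMost_Suc)
  also have "t 0 + (\<Sum>k\<le>n. real (n choose Suc k) *\<^sub>R t (Suc k))
      = (\<Sum>k\<le>Suc n. real (n choose k) *\<^sub>R t k)"
    by (simp add: sum.atMost_Suc_shift del: sum.atMost_Suc)
  also have "\<dots> = (\<Sum>k\<le>n. real (n choose k) *\<^sub>R t k)"
    by simp
  finally show ?thesis .
qed

text \<open>Since \<open>a * z = z * a - [z, a]\<close>, passing \<open>z\<close> from right to left is the difference of the commuting
  operations of left multiplication by \<open>z\<close> and bracketing with \<open>z\<close>; this is the binomial expansion
  of its \<open>n\<close>-th power.\<close>

lemma mult_power_eq_ad:
  fixes y z :: "('d, 'l::finite) tensor"
  shows "y * z ^ n = (\<Sum>k\<le>n. real (n choose k) *\<^sub>R (-1) ^ k *\<^sub>R (z ^ (n - k) * (lie_bracket z ^^ k) y))"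
proof (induction n)
  case (Suc n)
  let ?t = "\<lambda>k. (-1::real) ^ k *\<^sub>R (z ^ (Suc n - k) * (lie_bracket z ^^ k) y)"
  have "(-1::real) ^ k *\<^sub>R (z ^ (n - k) * (lie_bracket z ^^ k) y) * z = ?t k + ?t (Suc k)" if "k \<le> n" for k
  proof -
    have "(lie_bracket z ^^ k) y * z = z * (lie_bracket z ^^ k) y - (lie_bracket z ^^ Suc k) y"
      by (simp add: lie_bracket_def)
    then show ?thesis
      using that
      by (simp add: Suc_diff_le mult.assoc right_diff_distrib scaleR_diff_right power_commutes
          flip: power_Suc2 del: funpow.simps)
        (simp add: mult.assoc power_commutes flip: mult.assoc)
  qed
  then have "y * z ^ Suc n = (\<Sum>k\<le>n. real (n choose k) *\<^sub>R (?t k + ?t (Suc k)))"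
    unfolding power_Suc2 mult.assoc[symmetric] Suc sum_distrib_right
    by (intro sum.cong refl) (simp only: mult_scaleR_left atMost_iff)
  also have "\<dots> = (\<Sum>k\<le>Suc n. real (Suc n choose k) *\<^sub>R ?t k)"
    unfolding sum_Pascal scaleR_add_right sum.distrib ..
  finally show ?case .
qed simp

section \<open>The degree derivation and closure of the group under products\<close>

lift_definition degree_derivation :: "('d, 'l) tensor \<Rightarrow> ('d, 'l) tensor"
  is "\<lambda>x w. real (length w) * x w" by simp

text \<open>The inverse of the degree derivation on tensors without constant coefficient; at the empty word,
  division by zero returns 0.\<close>

lift_definition degree_antiderivation :: "('d, 'l) tensor \<Rightarrow> ('d, 'l) tensor"
  is "\<lambda>x w. x w / real (length w)" by simp

lemma linear_degree_derivation: "linear (degree_derivation :: ('d, 'l) tensor \<Rightarrow> _)"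
  by (rule linearI; transfer) (auto simp: algebra_simps)

lemma linear_degree_antiderivation: "linear (degree_antiderivation :: ('d, 'l) tensor \<Rightarrow> _)"
  by (rule linearI; transfer) (auto simp: add_divide_distrib)

lemma degree_derivation_mult:
  fixes x y :: "('d, 'l::finite) tensor"
  shows "degree_derivation (x * y) = degree_derivation x * y + x * degree_derivation y"
proof (rule tensor_eqI)
  fix w :: "'d list"
  have "real (length w) * (coeff x (take i w) * coeff y (drop i w))
      = real i * coeff x (take i w) * coeff y (drop i w)
        + coeff x (take i w) * (real (length w - i) * coeff y (drop i w))" if "i \<le> length w" for i
    using that by (simp add: algebra_simps)
  then show "coeff (degree_derivation (x * y)) w
      = coeff (degree_derivation x * y + x * degree_derivation y) w"
    by (simp add: degree_derivation.rep_eq times_tensor.rep_eq plus_tensor.rep_eq sum_distrib_left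
        min_absorb2 mult.assoc flip: sum.distrib)
qed

lemma degree_antiderivation_derivation:
  "vanishes_below 1 x \<Longrightarrow> degree_antiderivation (degree_derivation x) = x"
  by (rule tensor_eqI)
    (simp add: degree_derivation.rep_eq degree_antiderivation.rep_eq vanishes_below_def)

lemma degree_antiderivation_eq_0:
  "vanishes_below 1 x \<Longrightarrow> degree_antiderivation x = 0 \<Longrightarrow> x = 0"
  by (rule tensor_eqI, drule arg_cong[of _ _ coeff])
    (auto simp: degree_antiderivation.rep_eq vanishes_below_def zero_tensor.rep_eq fun_eq_iff)

lemma vanishes_below_degree_derivation: "vanishes_below n x \<Longrightarrow> vanishes_below n (degree_derivation x)"
  by (simp add: vanishes_below_def degree_derivation.rep_eq)

lemma vanishes_below_degree_derivation_1: "vanishes_below 1 (degree_derivation x)"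
  by (simp add: vanishes_below_def degree_derivation.rep_eq)

lemma vanishes_below_degree_antiderivation:
  "vanishes_below n x \<Longrightarrow> vanishes_below n (degree_antiderivation x)"
  by (simp add: vanishes_below_def degree_antiderivation.rep_eq)

lemma degree_derivation_letter: "degree_derivation (letter i) = letter i"
  by (rule tensor_eqI) (simp add: letter_def degree_derivation.rep_eq tensor_of_word.rep_eq)

lemma degree_derivation_free_lie:
  assumes "z \<in> \<gg>" shows "degree_derivation z \<in> (\<gg> :: ('d, 'l::finite) tensor set)"
proof -
  let ?S = "{x \<in> \<gg>. degree_derivation x \<in> (\<gg> :: ('d, 'l) tensor set)}"
  have "\<gg> \<subseteq> ?S"
  proof (rule free_lie_minimal)
    have "degree_derivation (lie_bracket v w)
        = lie_bracket (degree_derivation v) w + lie_bracket v (degree_derivation w)"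
      for v w :: "('d, 'l) tensor"
      by (simp add: lie_bracket_def degree_derivation_mult linear_diff[OF linear_degree_derivation])
    moreover have "subspace ?S"
      using subspace_free_lie by (auto simp: subspace_def linear_0[OF linear_degree_derivation]
          linear_add[OF linear_degree_derivation] linear_scale[OF linear_degree_derivation])
    ultimately show "lie_subalgebra ?S"
      unfolding lie_subalgebra_def
      by (auto intro: lie_bracket_free_lie subspace_add[OF subspace_free_lie])
  qed (simp add: degree_derivation_letter letter_free_lie)
  then show ?thesis using assms by auto
qed

text \<open>The derivation is injective on the finite-dimensional space \<open>\<gg>\<close> and maps it into itself, so it
  is onto; its inverse therefore preserves \<open>\<gg>\<close> as well.\<close>

lemma degree_antiderivation_free_lie:
  assumes "z \<in> \<gg>" shows "degree_antiderivation z \<in> (\<gg> :: ('d::finite, 'l::finite) tensor set)"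
proof -
  have "inj_on degree_derivation (\<gg> :: ('d, 'l) tensor set)"
    by (rule inj_on_inverseI[of _ degree_antiderivation])
      (simp add: degree_antiderivation_derivation[OF free_lie_vanishes_below])
  then have "dim (degree_derivation ` \<gg> :: ('d, 'l) tensor set) = dim (\<gg> :: ('d, 'l) tensor set)"
    by (intro dim_image_eq linear_degree_derivation) (simp add: span_eq_iff[THEN iffD2, OF subspace_free_lie])
  moreover have "degree_derivation ` \<gg> \<subseteq> (\<gg> :: ('d, 'l) tensor set)"
    using degree_derivation_free_lie by auto
  ultimately have "degree_derivation ` \<gg> = (\<gg> :: ('d, 'l) tensor set)"
    by (intro subspace_dim_equal) (auto intro: subspace_free_lie linear_subspace_image linear_degree_derivation)
  with assms obtain y where "y \<in> \<gg>" "z = degree_derivation y" by auto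
  then show ?thesis by (simp add: degree_antiderivation_derivation[OF free_lie_vanishes_below])
qed

text \<open>By the product rule each factor \<open>z\<close> is differentiated in turn and the result is moved past the powers
  to its right; the binomial coefficients add up along Pascal's rule.\<close>

lemma degree_derivation_power:
  fixes z :: "('d, 'l::finite) tensor"
  shows "degree_derivation (z ^ n)
    = (\<Sum>k<n. real (n choose Suc k) *\<^sub>R (-1) ^ k *\<^sub>R (z ^ (n - Suc k) * (lie_bracket z ^^ k) (degree_derivation z)))"
proof (induction n)
  case 0
  show ?case by (rule tensor_eqI) (simp add: degree_derivation.rep_eq one_tensor.rep_eq zero_tensor.rep_eq)
next
  case (Suc n)
  let ?t = "\<lambda>k. (-1::real) ^ k *\<^sub>R (z ^ (n - k) * (lie_bracket z ^^ k) (degree_derivation z))"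
  have "z * degree_derivation (z ^ n) = (\<Sum>k<n. real (n choose Suc k) *\<^sub>R ?t k)"
    unfolding Suc sum_distrib_left
    by (intro sum.cong refl) (simp add: Suc_diff_Suc mult.assoc[symmetric] flip: power_Suc)
  also have "\<dots> = (\<Sum>k\<le>n. real (n choose Suc k) *\<^sub>R ?t k)"
    by (simp add: lessThan_Suc_atMost[symmetric])
  finally have "degree_derivation (z ^ Suc n)
      = (\<Sum>k\<le>n. real (n choose k) *\<^sub>R ?t k) + (\<Sum>k\<le>n. real (n choose Suc k) *\<^sub>R ?t k)"
    by (simp only: power_Suc degree_derivation_mult mult_power_eq_ad[of "degree_derivation z"])
  also have "\<dots> = (\<Sum>k<Suc n. real (Suc n choose Suc k) *\<^sub>R ?t k)"
    by (simp only: lessThan_Suc_atMost sum.distrib[symmetric] scaleR_add_left[symmetric]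
        of_nat_add[symmetric] binomial_Suc_Suc)
  finally show ?case by simp
qed

lemma vanishes_below_power_div_fact:
  "vanishes_below 1 (z :: ('d, 'l::finite) tensor) \<Longrightarrow> vanishes_below n (z ^ n /\<^sub>R fact n)"
  by (intro vanishes_below_scaleR vanishes_below_power)

text \<open>This is \<open>exp (- c) * y * exp c\<close>, written as the series in iterated brackets that shows that it stays in
  the Lie algebra.\<close>

definition conjugate_by_exp :: "('d, 'l::finite) tensor \<Rightarrow> ('d, 'l) tensor \<Rightarrow> ('d, 'l) tensor"
  where "conjugate_by_exp c y = (\<Sum>k\<le>CARD('l). ((-1) ^ k / fact k) *\<^sub>R (lie_bracket c ^^ k) y)"

text \<open>This is \<open>exp (- c) * Y (exp c)\<close> for the degree derivation \<open>Y\<close>, that is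
  \<open>((1 - exp (- ad c)) / ad c) (Y c)\<close>, again as a series in iterated brackets.\<close>

definition exp_log_derivative :: "('d, 'l::finite) tensor \<Rightarrow> ('d, 'l) tensor"
  where "exp_log_derivative c
    = (\<Sum>k<CARD('l). ((-1) ^ k / fact (Suc k)) *\<^sub>R (lie_bracket c ^^ k) (degree_derivation c))"

lemma mult_exp_eq_exp_mult_conjugate:
  fixes c y :: "('d::finite, 'l::finite) tensor"
  assumes "vanishes_below 1 c"
  shows "y * tensor_exp c = tensor_exp c * conjugate_by_exp c y"
proof -
  let ?a = "\<lambda>n. c ^ n /\<^sub>R fact n" and ?b = "\<lambda>k. ((-1) ^ k / fact k) *\<^sub>R (lie_bracket c ^^ k) y"
  have "y * ?a n = (\<Sum>k\<le>n. ?a (n - k) * ?b k)" for n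
    by (simp add: mult_power_eq_ad scaleR_sum_right)
      (auto intro!: sum.cong simp: binomial_fact field_simps)
  then have "y * tensor_exp c = (\<Sum>n\<le>CARD('l). \<Sum>k\<le>n. ?a (n - k) * ?b k)"
    by (simp add: tensor_exp_eq_sum[OF assms] sum_distrib_left)
  also have "\<dots> = (\<Sum>n\<le>CARD('l). ?a n) * (\<Sum>k\<le>CARD('l). ?b k)"
  proof (rule sum_Cauchy_product_filtered)
    show "vanishes_below n (?b n)" for n
      using vanishes_below_ad_power[OF assms, of 0 y n] by (intro vanishes_below_scaleR) simp
  qed (rule vanishes_below_power_div_fact[OF assms])
  finally show ?thesis
    by (simp add: tensor_exp_eq_sum[OF assms] conjugate_by_exp_def)
qed

lemma degree_derivation_exp:
  fixes c :: "('d::finite, 'l::finite) tensor"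
  assumes "vanishes_below 1 c"
  shows "degree_derivation (tensor_exp c) = tensor_exp c * exp_log_derivative c"
proof -
  let ?b' = "\<lambda>k. ((-1) ^ k / fact (Suc k)) *\<^sub>R (lie_bracket c ^^ k) (degree_derivation c)"
  let ?a = "\<lambda>n. c ^ n /\<^sub>R fact n" and ?b = "\<lambda>k. case k of 0 \<Rightarrow> 0 | Suc k \<Rightarrow> ?b' k"
  \<comment> \<open>Differentiation lowers the power of \<open>c\<close> by one, hence the index shift in \<open>?b\<close>.\<close>
  have "degree_derivation (?a n) = (\<Sum>k\<le>n. ?a (n - k) * ?b k)" for n
  proof -
    have "degree_derivation (?a n) = (\<Sum>k<n. ?a (n - Suc k) * ?b' k)"
      by (simp add: degree_derivation_power linear_scale[OF linear_degree_derivation] scaleR_sum_right)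
        (auto intro!: sum.cong simp: binomial_fact field_simps)
    also have "\<dots> = (\<Sum>k\<le>n. ?a (n - k) * ?b k)"
      by (cases n) (simp_all add: sum.atMost_Suc_shift lessThan_Suc_atMost mult.commute
          del: sum.atMost_Suc)
    finally show ?thesis .
  qed
  then have "degree_derivation (tensor_exp c) = (\<Sum>n\<le>CARD('l). \<Sum>k\<le>n. ?a (n - k) * ?b k)"
    by (simp add: tensor_exp_eq_sum[OF assms] linear_sum[OF linear_degree_derivation])
  also have "\<dots> = (\<Sum>n\<le>CARD('l). ?a n) * (\<Sum>k\<le>CARD('l). ?b k)"
  proof (rule sum_Cauchy_product_filtered)
    show "vanishes_below n (?b n)" for n
      using vanishes_below_ad_power[OF assms vanishes_below_degree_derivation_1, of "n - 1" c]
      by (cases n) (auto intro!: vanishes_below_scaleR)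
  qed (rule vanishes_below_power_div_fact[OF assms])
  also have "(\<Sum>k\<le>CARD('l). ?b k) = exp_log_derivative c"
    by (simp add: exp_log_derivative_def sum.atMost_shift)
  finally show ?thesis
    by (simp add: tensor_exp_eq_sum[OF assms])
qed

lemma conjugate_by_exp_free_lie: "c \<in> \<gg> \<Longrightarrow> y \<in> \<gg> \<Longrightarrow> conjugate_by_exp c y \<in> \<gg>"
  unfolding conjugate_by_exp_def
  by (intro subspace_sum subspace_scale subspace_free_lie ad_power_free_lie)

lemma exp_log_derivative_free_lie: "c \<in> \<gg> \<Longrightarrow> exp_log_derivative c \<in> \<gg>"
  unfolding exp_log_derivative_def
  by (intro subspace_sum subspace_scale subspace_free_lie ad_power_free_lie degree_derivation_free_lie)

text \<open>The lowest-degree part of the difference comes from the term without brackets alone, since each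
  bracket with \<open>c\<close> raises the degree.\<close>

lemma exp_log_derivative_diff:
  fixes c c' :: "('d, 'l::finite) tensor"
  assumes c: "vanishes_below 1 c" "vanishes_below 1 c'" "vanishes_below j (c - c')"
  shows "vanishes_below (Suc j)
    (exp_log_derivative c - exp_log_derivative c' - degree_derivation (c - c'))"
proof -
  let ?A = "\<lambda>k. (lie_bracket c ^^ k) (degree_derivation c) - (lie_bracket c' ^^ k) (degree_derivation c')"
  let ?r = "\<lambda>k. (-1) ^ k / fact (Suc k) :: real"
  have "exp_log_derivative c - exp_log_derivative c' = (\<Sum>k<CARD('l). ?r k *\<^sub>R ?A k)"
    by (simp add: exp_log_derivative_def sum_subtractf scaleR_diff_right)
  also have "\<dots> = degree_derivation (c - c') + (\<Sum>k\<in>{..<CARD('l)} - {0}. ?r k *\<^sub>R ?A k)"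
    by (subst sum.remove[of _ 0]) (auto simp: linear_diff[OF linear_degree_derivation])
  finally have "exp_log_derivative c - exp_log_derivative c' - degree_derivation (c - c')
      = (\<Sum>k\<in>{..<CARD('l)} - {0}. ?r k *\<^sub>R ?A k)" by simp
  moreover have "vanishes_below (j + k) (?A k)" for k
    using vanishes_below_ad_power_diff[OF c vanishes_below_degree_derivation_1, of "degree_derivation c"]
      vanishes_below_degree_derivation[OF c(3)] by (simp add: linear_diff[OF linear_degree_derivation])
  then have "vanishes_below (Suc j) (?A k)" if "k \<in> {..<CARD('l)} - {0}" for k
    using that by (intro vanishes_below_mono[of "j + k" _ "Suc j"]) auto
  ultimately show ?thesis
    by (simp only: vanishes_below_sum vanishes_below_scaleR)
qed

text \<open>Solve \<open>exp_log_derivative c = l\<close> by Picard iteration: the left side is the degree derivation of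
  \<open>c\<close> up to terms of higher degree, so that \<open>c \<mapsto> c + Y\<^sup>-\<^sup>1 (l - exp_log_derivative c)\<close> is a
  contraction.\<close>

lemma exp_log_derivative_surj:
  fixes l :: "('d::finite, 'l::finite) tensor"
  assumes "l \<in> \<gg>"
  shows "\<exists>c\<in>\<gg>. exp_log_derivative c = l"
proof -
  let ?F = "\<lambda>c. c + degree_antiderivation (l - exp_log_derivative c)"
  have "\<exists>!c. c \<in> \<gg> \<and> ?F c = c"
  proof (rule filtration_contraction_unique_fixpoint)
    show "0 \<in> (\<gg> :: ('d, 'l) tensor set)" by (rule subspace_0[OF subspace_free_lie])
    show "?F c \<in> \<gg>" if "c \<in> \<gg>" for c
      using that assms by (intro subspace_add subspace_diff subspace_free_lie degree_antiderivation_free_lie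
          exp_log_derivative_free_lie)
    fix k and c c' :: "('d, 'l) tensor"
    assume c: "c \<in> \<gg>" "c' \<in> \<gg>" "vanishes_below k (c - c')"
    have c1: "vanishes_below 1 (c - c')"
      by (intro vanishes_below_diff free_lie_vanishes_below c)
    have "?F c - ?F c' = - degree_antiderivation
        (exp_log_derivative c - exp_log_derivative c' - degree_derivation (c - c'))"
      by (simp add: linear_diff[OF linear_degree_antiderivation]
          degree_antiderivation_derivation[OF c1])
    then show "vanishes_below (Suc k) (?F c - ?F c')"
      by (simp only:) (intro vanishes_below_uminus vanishes_below_degree_antiderivation
          exp_log_derivative_diff free_lie_vanishes_below c)
  qed
  then obtain c where c: "c \<in> \<gg>" "degree_antiderivation (l - exp_log_derivative c) = 0" by auto
  have "l - exp_log_derivative c = 0"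
    by (rule degree_antiderivation_eq_0[OF free_lie_vanishes_below c(2)])
      (intro subspace_diff subspace_free_lie assms exp_log_derivative_free_lie c(1))
  with c(1) show ?thesis by auto
qed

lemma coeff_mult_Nil: "coeff (x * y) [] = coeff x [] * coeff (y :: ('d, 'l::finite) tensor) []"
  by (simp add: times_tensor.rep_eq)

lemma coeff_exp_Nil:
  assumes "vanishes_below 1 (z :: ('d::finite, 'l::finite) tensor)"
  shows "coeff (tensor_exp z) [] = 1"
  using vanishes_below_tensor_exp[OF assms]
  by (simp add: vanishes_below_def minus_tensor.rep_eq one_tensor.rep_eq)

text \<open>Comparing coefficients of \<open>w\<close> gives \<open>length w * g w\<close> in terms of the coefficients of \<open>g\<close> at proper
  prefixes of \<open>w\<close>, because \<open>l\<close> has no constant coefficient.\<close>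

lemma degree_equation_unique:
  fixes g h l :: "('d, 'l::finite) tensor"
  assumes g: "degree_derivation g = g * l" and h: "degree_derivation h = h * l"
    and l: "vanishes_below 1 l" and eq: "coeff g [] = coeff h []"
  shows "g = h"
proof (rule tensor_eqI)
  fix w
  show "coeff g w = coeff h w"
  proof (induction w rule: length_induct)
    case (1 w)
    have "coeff g (take i w) * coeff l (drop i w) = coeff h (take i w) * coeff l (drop i w)"
      if "i \<le> length w" for i
      using 1 that l by (cases "i = length w") (auto simp: vanishes_below_def)
    then have "coeff (g * l) w = coeff (h * l) w"
      unfolding times_tensor.rep_eq by (auto intro!: sum.cong)
    then have "real (length w) * coeff g w = real (length w) * coeff h w"
      by (simp flip: g h add: degree_derivation.rep_eq)
    with eq show ?case by (cases "w = []") auto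
  qed
qed

text \<open>The product satisfies the degree equation of an element \<open>l\<close> of \<open>\<gg>\<close>; so does \<open>exp c\<close> for a
  solution \<open>c \<in> \<gg>\<close> of \<open>exp_log_derivative c = l\<close>, and the solution of a degree equation is unique.\<close>

lemma free_nilpotent_group_mult:
  assumes "g \<in> free_nilpotent_group" "h \<in> free_nilpotent_group"
  shows "g * h \<in> (free_nilpotent_group :: ('d::finite, 'l::finite) tensor set)"
proof -
  from assms obtain a b where a: "a \<in> \<gg>" "g = tensor_exp a" and b: "b \<in> \<gg>" "h = tensor_exp b"
    unfolding free_nilpotent_group_def by auto
  note a1 = free_lie_vanishes_below[OF a(1)] and b1 = free_lie_vanishes_below[OF b(1)]
  let ?l = "conjugate_by_exp b (exp_log_derivative a) + exp_log_derivative b"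
  have "?l \<in> \<gg>"
    by (intro subspace_add subspace_free_lie conjugate_by_exp_free_lie exp_log_derivative_free_lie a b)
  then obtain c where c: "c \<in> \<gg>" "exp_log_derivative c = ?l"
    using exp_log_derivative_surj by blast
  note c1 = free_lie_vanishes_below[OF c(1)]
  have "g * h = tensor_exp c"
  proof (rule degree_equation_unique[where l = ?l])
    have "degree_derivation (g * h) = g * (exp_log_derivative a * h) + g * (h * exp_log_derivative b)"
      by (simp add: degree_derivation_mult degree_derivation_exp a b a1[simplified] b1[simplified] mult.assoc)
    also have "exp_log_derivative a * h = h * conjugate_by_exp b (exp_log_derivative a)"
      unfolding b(2) by (rule mult_exp_eq_exp_mult_conjugate[OF b1])
    finally show "degree_derivation (g * h) = g * h * ?l"
      by (simp add: distrib_left mult.assoc)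
    show "degree_derivation (tensor_exp c) = tensor_exp c * ?l"
      using degree_derivation_exp[OF c1] c(2) by simp
    show "vanishes_below 1 ?l"
      using \<open>?l \<in> \<gg>\<close> by (rule free_lie_vanishes_below)
    show "coeff (g * h) [] = coeff (tensor_exp c) []"
      by (simp add: coeff_mult_Nil a b coeff_exp_Nil[OF a1] coeff_exp_Nil[OF b1] coeff_exp_Nil[OF c1])
  qed
  with c(1) show ?thesis unfolding free_nilpotent_group_def by auto
qed

section \<open>Shuffles and group-like elements\<close>

text \<open>A list and not a set, because a word that arises from several shuffles counts several times.\<close>

fun shuffle_list :: "'a list \<Rightarrow> 'a list \<Rightarrow> 'a list list" where
  "shuffle_list [] v = [v]"
| "shuffle_list (a # u) [] = [a # u]"
| "shuffle_list (a # u) (b # v)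
    = map ((#) a) (shuffle_list u (b # v)) @ map ((#) b) (shuffle_list (a # u) v)"

lemma length_shuffle_list: "w \<in> set (shuffle_list u v) \<Longrightarrow> length w = length u + length v"
  by (induction u v arbitrary: w rule: shuffle_list.induct) auto

text \<open>The linear extension of \<open>f\<close> to the shuffle product of \<open>u\<close> and \<open>v\<close>; as a function of the pair
  \<open>(u, v)\<close> it is the shuffle coproduct of \<open>f\<close>.\<close>

definition shuffle_pairing :: "('a list \<Rightarrow> real) \<Rightarrow> 'a list \<Rightarrow> 'a list \<Rightarrow> real"
  where "shuffle_pairing f u v = (\<Sum>w\<leftarrow>shuffle_list u v. f w)"

lemma shuffle_pairing_Nil [simp]:
  "shuffle_pairing f [] v = f v" "shuffle_pairing f u [] = f u"
  unfolding shuffle_pairing_def by (simp, cases u, simp_all)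

lemma shuffle_pairing_Cons:
  "shuffle_pairing f (a # u) (b # v)
    = shuffle_pairing (\<lambda>w. f (a # w)) u (b # v) + shuffle_pairing (\<lambda>w. f (b # w)) (a # u) v"
  by (simp add: shuffle_pairing_def o_def)

lemma shuffle_pairing_cong:
  assumes "\<And>w. length w = length u + length v \<Longrightarrow> f w = g w"
  shows "shuffle_pairing f u v = shuffle_pairing g u v"
  unfolding shuffle_pairing_def
  by (intro arg_cong[of _ _ sum_list] map_cong refl assms length_shuffle_list)

lemma shuffle_pairing_add:
  "shuffle_pairing (\<lambda>w. f w + g w) u v = shuffle_pairing f u v + shuffle_pairing g u v"
  by (simp add: shuffle_pairing_def sum_list_addf)

lemma shuffle_pairing_mult: "shuffle_pairing (\<lambda>w. c * f w) u v = c * shuffle_pairing f u v"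
  by (simp add: shuffle_pairing_def sum_list_const_mult)

lemma shuffle_pairing_0 [simp]: "shuffle_pairing (\<lambda>w. 0) u v = 0"
  using shuffle_pairing_mult[of 0] by simp

text \<open>The product of tensors without the truncation. Induction on words needs it, since prefixing a
  letter changes the length at which the truncation acts.\<close>

definition concat_product :: "('a list \<Rightarrow> real) \<Rightarrow> ('a list \<Rightarrow> real) \<Rightarrow> 'a list \<Rightarrow> real"
  where "concat_product f g w = (\<Sum>i\<le>length w. f (take i w) * g (drop i w))"

lemma concat_product_Cons:
  "concat_product f g (a # w) = f [] * g (a # w) + concat_product (\<lambda>w. f (a # w)) g w"
  by (simp add: concat_product_def sum.atMost_Suc_shift del: sum.atMost_Suc)

text \<open>The bialgebra law: splitting a shuffle of \<open>u\<close> and \<open>v\<close> in two splits \<open>u\<close> and \<open>v\<close>, and both pieces are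
  shuffles of the respective pieces.\<close>

lemma shuffle_pairing_concat_product:
  "shuffle_pairing (concat_product f g) u v = (\<Sum>i\<le>length u. \<Sum>j\<le>length v.
    shuffle_pairing f (take i u) (take j v) * shuffle_pairing g (drop i u) (drop j v))"
proof (induction u v arbitrary: f rule: shuffle_list.induct)
  case (3 a u b v)
  show ?case
    by (simp add: shuffle_pairing_Cons concat_product_Cons[abs_def] shuffle_pairing_add
        shuffle_pairing_mult 3[abs_def] sum.atMost_Suc_shift sum.distrib algebra_simps
        del: sum.atMost_Suc)
qed (simp_all add: concat_product_def)

lemma coeff_mult_eq_concat_product:
  fixes x y :: "('d, 'l::finite) tensor"
  assumes "length w \<le> CARD('l)"
  shows "coeff (x * y) w = concat_product (coeff x) (coeff y) w"
  using assms by (simp add: times_tensor.rep_eq concat_product_def)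

lemma shuffle_pairing_mult_tensor:
  fixes x y :: "('d, 'l::finite) tensor"
  assumes "length u + length v \<le> CARD('l)"
  shows "shuffle_pairing (coeff (x * y)) u v = (\<Sum>i\<le>length u. \<Sum>j\<le>length v.
    shuffle_pairing (coeff x) (take i u) (take j v) * shuffle_pairing (coeff y) (drop i u) (drop j v))"
  unfolding shuffle_pairing_concat_product[symmetric]
  using assms by (intro shuffle_pairing_cong coeff_mult_eq_concat_product) simp

lemma shuffle_pairing_long:
  assumes "CARD('l) < length u + length v"
  shows "shuffle_pairing (coeff (x :: ('d, 'l) tensor)) u v = 0"
proof -
  have "shuffle_pairing (coeff x) u v = shuffle_pairing (\<lambda>_. 0) u v"
    using assms by (intro shuffle_pairing_cong coeff_long) simp
  then show ?thesis by simp
qed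

definition primitive :: "('d, 'l) tensor \<Rightarrow> bool"
  where "primitive x \<longleftrightarrow> coeff x [] = 0 \<and>
    (\<forall>u v. u \<noteq> [] \<longrightarrow> v \<noteq> [] \<longrightarrow> shuffle_pairing (coeff x) u v = 0)"

text \<open>In the bialgebra law only the two splittings survive that put all of \<open>u\<close> on one side and all of
  \<open>v\<close> on the other. The result is symmetric in \<open>x\<close> and \<open>y\<close>, which is why brackets of primitive
  elements are primitive.\<close>

lemma shuffle_pairing_mult_primitive:
  fixes x y :: "('d, 'l::finite) tensor"
  assumes "primitive x" "primitive y" "u \<noteq> []" "v \<noteq> []" "length u + length v \<le> CARD('l)"
  shows "shuffle_pairing (coeff (x * y)) u v
    = coeff x u * coeff y v + coeff x v * coeff y u"
proof -
  let ?m = "length u" and ?n = "length v"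
  have "shuffle_pairing (coeff x) (take i u) (take j v) * shuffle_pairing (coeff y) (drop i u) (drop j v)
      = (if i = ?m then if j = 0 then coeff x u * coeff y v else 0 else 0)
        + (if i = 0 then if j = ?n then coeff x v * coeff y u else 0 else 0)"
    if "i \<le> ?m" "j \<le> ?n" for i j
    using assms that by (cases "i = 0"; cases "j = 0"; cases "i = ?m"; cases "j = ?n")
      (auto simp: primitive_def)
  then have "shuffle_pairing (coeff (x * y)) u v = (\<Sum>i\<le>?m. \<Sum>j\<le>?n.
      (if i = ?m then if j = 0 then coeff x u * coeff y v else 0 else 0)
        + (if i = 0 then if j = ?n then coeff x v * coeff y u else 0 else 0))"
    unfolding shuffle_pairing_mult_tensor[OF assms(5)] by (intro sum.cong refl) simp
  also have "\<dots> = (\<Sum>i\<le>?m. (if i = ?m then coeff x u * coeff y v else 0)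
        + (if i = 0 then coeff x v * coeff y u else 0))"
    by (intro sum.cong refl) (auto simp: sum.distrib)
  also have "\<dots> = coeff x u * coeff y v + coeff x v * coeff y u"
    by (simp add: sum.distrib)
  finally show ?thesis .
qed

lemma primitive_free_lie:
  assumes "z \<in> \<gg>" shows "primitive (z :: ('d, 'l::finite) tensor)"
proof -
  have "\<gg> \<subseteq> {x :: ('d, 'l) tensor. primitive x}"
  proof (rule free_lie_minimal)
    have "subspace {x :: ('d, 'l) tensor. primitive x}"
      by (auto simp: subspace_def primitive_def zero_tensor.rep_eq plus_tensor.rep_eq
          scaleR_tensor.rep_eq shuffle_pairing_add shuffle_pairing_mult)
    moreover have "primitive (lie_bracket x y)"
      if xy: "primitive x" "primitive y" for x y :: "('d, 'l) tensor"
      unfolding primitive_def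
    proof (intro conjI allI impI)
      show "coeff (lie_bracket x y) [] = 0"
        using xy by (simp add: lie_bracket_def minus_tensor.rep_eq coeff_mult_Nil primitive_def)
      fix u v :: "'d list"
      assume uv: "u \<noteq> []" "v \<noteq> []"
      show "shuffle_pairing (coeff (lie_bracket x y)) u v = 0"
      proof (cases "length u + length v \<le> CARD('l)")
        case True
        have "shuffle_pairing (coeff (x * y)) u v
            = shuffle_pairing (\<lambda>w. coeff (lie_bracket x y) w + coeff (y * x) w) u v"
          by (simp add: lie_bracket_def minus_tensor.rep_eq)
        then show ?thesis
          unfolding shuffle_pairing_add shuffle_pairing_mult_primitive[OF xy uv True]
            shuffle_pairing_mult_primitive[OF xy(2,1) uv True] by simp
      qed (simp add: shuffle_pairing_long)
    qed
    ultimately show "lie_subalgebra {x :: ('d, 'l) tensor. primitive x}"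
      by (auto simp: lie_subalgebra_def)
    show "letter i \<in> {x :: ('d, 'l) tensor. primitive x}" for i
    proof (clarsimp simp: primitive_def, intro conjI allI impI)
      fix u v :: "'d list"
      assume "u \<noteq> []" "v \<noteq> []"
      then have "length u \<ge> 1" "length v \<ge> 1" by (simp_all add: Suc_le_eq)
      then have "shuffle_pairing (coeff (letter i :: ('d, 'l) tensor)) u v = shuffle_pairing (\<lambda>_. 0) u v"
        by (intro shuffle_pairing_cong) (auto simp: letter_def tensor_of_word.rep_eq)
      then show "shuffle_pairing (coeff (letter i :: ('d, 'l) tensor)) u v = 0" by simp
    qed (simp add: letter_def tensor_of_word.rep_eq)
  qed
  then show ?thesis using assms by auto
qed

lemma sum_boundary_rectangle:
  fixes F :: "nat \<Rightarrow> nat \<Rightarrow> real"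
  assumes "\<And>i j. i < m \<Longrightarrow> j < n \<Longrightarrow> F i j = 0" "F m n = 0"
  shows "(\<Sum>i\<le>m. \<Sum>j\<le>n. F i j) = (\<Sum>i\<le>m. F i n) + (\<Sum>j\<le>n. F m j)"
proof -
  have "(\<Sum>i\<le>m. \<Sum>j\<le>n. F i j) = (\<Sum>i<m. (\<Sum>j<n. F i j) + F i n) + (\<Sum>j\<le>n. F m j)"
    by (simp flip: lessThan_Suc_atMost)
  also have "(\<Sum>i<m. (\<Sum>j<n. F i j) + F i n) = (\<Sum>i<m. F i n)"
    using assms(1) by (intro sum.cong) auto
  also have "\<dots> = (\<Sum>i\<le>m. F i n)"
    using assms(2) by (simp flip: lessThan_Suc_atMost)
  finally show ?thesis .
qed

text \<open>Apply the degree equation \<open>Y g = g * l\<close> to the shuffles of \<open>u\<close> and \<open>v\<close>. As \<open>l\<close> is primitive, only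
  splittings that leave all of \<open>u\<close> or all of \<open>v\<close> on the left contribute, and the induction hypothesis turns
  them into \<open>length u * g u * g v\<close> and \<open>g u * (length v * g v)\<close>. The bound on the lengths cannot be
  dropped: the truncated coefficients on the left vanish beyond it, the product on the right need not.\<close>

lemma exp_group_like:
  fixes c :: "('d::finite, 'l::finite) tensor"
  assumes "c \<in> \<gg>" "length u + length v \<le> CARD('l)"
  shows "shuffle_pairing (coeff (tensor_exp c)) u v = coeff (tensor_exp c) u * coeff (tensor_exp c) v"
  using assms(2)
proof (induction "length u + length v" arbitrary: u v rule: less_induct)
  case less
  define g where "g = tensor_exp c"
  define l where "l = exp_log_derivative c"
  note c1 = free_lie_vanishes_below[OF assms(1)]
  have deg: "degree_derivation g = g * l"
    unfolding g_def l_def by (rule degree_derivation_exp[OF c1])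
  have deg_coeff: "real (length w) * coeff g w = (\<Sum>i\<le>length w. coeff g (take i w) * coeff l (drop i w))"
    if "length w \<le> CARD('l)" for w
    using arg_cong[OF deg, of "\<lambda>x. coeff x w"] that
    by (simp add: degree_derivation.rep_eq times_tensor.rep_eq)
  have l: "primitive l" unfolding l_def by (intro primitive_free_lie exp_log_derivative_free_lie assms)
  have g1: "coeff g [] = 1" unfolding g_def by (rule coeff_exp_Nil[OF c1])
  have IH: "shuffle_pairing (coeff g) u' v' = coeff g u' * coeff g v'"
    if "length u' + length v' < length u + length v" for u' v'
    unfolding g_def using that less.prems by (intro less.hyps) auto
  show ?case
  proof (cases "u = [] \<or> v = []")
    case False
    let ?F = "\<lambda>i j. shuffle_pairing (coeff g) (take i u) (take j v)
      * shuffle_pairing (coeff l) (drop i u) (drop j v)"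
    have "real (length u + length v) * shuffle_pairing (coeff g) u v
        = shuffle_pairing (\<lambda>w. real (length u + length v) * coeff g w) u v"
      by (simp add: shuffle_pairing_mult)
    also have "\<dots> = shuffle_pairing (coeff (g * l)) u v"
      by (rule shuffle_pairing_cong) (simp flip: deg add: degree_derivation.rep_eq)
    also have "\<dots> = (\<Sum>i\<le>length u. \<Sum>j\<le>length v. ?F i j)"
      by (rule shuffle_pairing_mult_tensor[OF less.prems])
    also have "\<dots> = (\<Sum>i\<le>length u. ?F i (length v)) + (\<Sum>j\<le>length v. ?F (length u) j)"
      by (rule sum_boundary_rectangle) (use l in \<open>auto simp: primitive_def\<close>)
    also have "(\<Sum>i\<le>length u. ?F i (length v))
        = (\<Sum>i\<le>length u. coeff g v * (coeff g (take i u) * coeff l (drop i u)))"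
    proof (intro sum.cong refl)
      fix i assume "i \<in> {..length u}"
      then show "?F i (length v) = coeff g v * (coeff g (take i u) * coeff l (drop i u))"
        using l by (cases "i = length u") (auto simp: IH primitive_def)
    qed
    also have "\<dots> = coeff g v * (real (length u) * coeff g u)"
      using less.prems by (simp add: deg_coeff sum_distrib_left)
    also have "(\<Sum>j\<le>length v. ?F (length u) j)
        = (\<Sum>j\<le>length v. coeff g u * (coeff g (take j v) * coeff l (drop j v)))"
    proof (intro sum.cong refl)
      fix j assume "j \<in> {..length v}"
      then show "?F (length u) j = coeff g u * (coeff g (take j v) * coeff l (drop j v))"
        using l by (cases "j = length v") (auto simp: IH primitive_def)
    qed
    also have "\<dots> = coeff g u * (real (length v) * coeff g v)"
      using less.prems by (simp add: deg_coeff sum_distrib_left)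
    finally have "real (length u + length v) * shuffle_pairing (coeff g) u v
        = real (length u + length v) * (coeff g u * coeff g v)"
      by (simp add: algebra_simps)
    moreover have "real (length u + length v) \<noteq> 0" using False by (cases u) simp_all
    ultimately show ?thesis unfolding g_def using mult_left_cancel by blast
  qed (use g1 in \<open>auto simp: g_def\<close>)
qed

section \<open>The logarithm is linear on the group\<close>

text \<open>Recording the length \<open>n\<close> of the words that are used has two purposes: it keeps products below the
  truncation length, and it makes the linear extension of the logarithm respect the filtration.\<close>

definition linear_on_group :: "nat \<Rightarrow> (('d::finite, 'l::finite) tensor \<Rightarrow> real) \<Rightarrow> bool"
  where "linear_on_group n f \<longleftrightarrow> (\<exists>c. \<forall>g\<in>free_nilpotent_group.
    f g = (\<Sum>w | length w \<le> n. c w * coeff g w))"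

lemma linear_on_group_cong:
  "linear_on_group n f \<Longrightarrow> (\<And>g. g \<in> free_nilpotent_group \<Longrightarrow> f' g = f g) \<Longrightarrow> linear_on_group n f'"
  unfolding linear_on_group_def by simp

lemma linear_on_group_coeff:
  assumes "length w \<le> n"
  shows "linear_on_group n (\<lambda>g. coeff g w)"
  unfolding linear_on_group_def
proof (intro exI ballI)
  fix g :: "('a, 'b) tensor"
  have "(\<Sum>v | length v \<le> n. (if v = w then 1 else 0) * coeff g v) = (\<Sum>v\<in>{w}. coeff g v)"
    by (rule sum.mono_neutral_cong_right) (use assms in \<open>auto simp: finite_short_words\<close>)
  then show "coeff g w = (\<Sum>v | length v \<le> n. (if v = w then 1 else 0) * coeff g v)"
    by simp
qed

lemma linear_on_group_0: "linear_on_group n (\<lambda>_. 0)"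
  unfolding linear_on_group_def by (auto intro!: exI[of _ "\<lambda>_. 0"])

lemma linear_on_group_add:
  assumes "linear_on_group n f" "linear_on_group n h"
  shows "linear_on_group n (\<lambda>g. f g + h g)"
proof -
  from assms obtain c d where
    "\<forall>g\<in>free_nilpotent_group. f g = (\<Sum>w | length w \<le> n. c w * coeff g w)"
    "\<forall>g\<in>free_nilpotent_group. h g = (\<Sum>w | length w \<le> n. d w * coeff g w)"
    unfolding linear_on_group_def by auto
  then show ?thesis
    unfolding linear_on_group_def
    by (intro exI[of _ "\<lambda>w. c w + d w"]) (simp add: distrib_right sum.distrib)
qed

lemma linear_on_group_scale:
  assumes "linear_on_group n f"
  shows "linear_on_group n (\<lambda>g. r * f g)"
proof -
  from assms obtain c where
    "\<forall>g\<in>free_nilpotent_group. f g = (\<Sum>w | length w \<le> n. c w * coeff g w)"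
    unfolding linear_on_group_def by auto
  then show ?thesis
    unfolding linear_on_group_def
    by (intro exI[of _ "\<lambda>w. r * c w"]) (simp add: sum_distrib_left mult.assoc)
qed

lemma linear_on_group_sum:
  "(\<And>i. i \<in> I \<Longrightarrow> linear_on_group n (f i)) \<Longrightarrow> linear_on_group n (\<lambda>g. \<Sum>i\<in>I. f i g)"
  by (induction I rule: infinite_finite_induct) (simp_all add: linear_on_group_0 linear_on_group_add)

lemma linear_on_group_sum_list:
  "(\<And>w. w \<in> set ws \<Longrightarrow> length w \<le> n) \<Longrightarrow> linear_on_group n (\<lambda>g. \<Sum>w\<leftarrow>ws. coeff g w)"
  by (induction ws) (simp_all add: linear_on_group_0 linear_on_group_add linear_on_group_coeff)

lemma linear_on_group_mult:
  fixes f h :: "('d::finite, 'l::finite) tensor \<Rightarrow> real"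
  assumes "linear_on_group m f" "linear_on_group n h" "m + n \<le> CARD('l)"
  shows "linear_on_group (m + n) (\<lambda>g. f g * h g)"
proof -
  from assms obtain c d where
    cd: "\<And>g. g \<in> free_nilpotent_group \<Longrightarrow> f g = (\<Sum>u | length u \<le> m. c u * coeff g u)"
    "\<And>g. g \<in> free_nilpotent_group \<Longrightarrow> h g = (\<Sum>v | length v \<le> n. d v * coeff g v)"
    unfolding linear_on_group_def by auto
  have "linear_on_group (m + n) (\<lambda>g. \<Sum>u | length u \<le> m. \<Sum>v | length v \<le> n.
      (c u * d v) * (\<Sum>w\<leftarrow>shuffle_list u v. coeff g w))"
    by (intro linear_on_group_sum linear_on_group_scale linear_on_group_sum_list)
      (auto dest: length_shuffle_list)
  then show ?thesis
  proof (rule linear_on_group_cong)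
    fix g :: "('d, 'l) tensor"
    assume g: "g \<in> free_nilpotent_group"
    then obtain z where z: "z \<in> \<gg>" "g = tensor_exp z" unfolding free_nilpotent_group_def by auto
    show "f g * h g = (\<Sum>u | length u \<le> m. \<Sum>v | length v \<le> n.
        (c u * d v) * (\<Sum>w\<leftarrow>shuffle_list u v. coeff g w))"
      unfolding cd[OF g] sum_product
    proof (intro sum.cong refl)
      fix u v :: "'d list"
      assume "u \<in> {u. length u \<le> m}" "v \<in> {v. length v \<le> n}"
      with assms(3) have "(\<Sum>w\<leftarrow>shuffle_list u v. coeff g w) = coeff g u * coeff g v"
        unfolding z(2) by (subst exp_group_like[OF z(1), symmetric]) (auto simp: shuffle_pairing_def)
      then show "c u * coeff g u * (d v * coeff g v)
          = (c u * d v) * (\<Sum>w\<leftarrow>shuffle_list u v. coeff g w)"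
        by simp
    qed
  qed
qed

lemma group_vanishes_below:
  "g \<in> free_nilpotent_group \<Longrightarrow> vanishes_below 1 (g - 1)"
  unfolding free_nilpotent_group_def using free_lie_vanishes_below vanishes_below_tensor_exp by blast

lemma linear_on_group_power_coeff:
  fixes w :: "'d::finite list"
  assumes "length w \<le> CARD('l::finite)"
  shows "linear_on_group (length w) (\<lambda>g :: ('d, 'l) tensor. coeff ((g - 1) ^ k) w)"
  using assms
proof (induction k arbitrary: w)
  have Nil: "coeff g [] = 1" if "g \<in> free_nilpotent_group" for g :: "('d, 'l) tensor"
    using group_vanishes_below[OF that]
    by (simp add: vanishes_below_def minus_tensor.rep_eq one_tensor.rep_eq)
  {
    case 0
    have "linear_on_group (length w) (\<lambda>g :: ('d, 'l) tensor. (if w = [] then 1 else 0) * coeff g [])"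
      by (intro linear_on_group_scale linear_on_group_coeff) simp
    then show ?case
      by (rule linear_on_group_cong) (simp add: one_tensor.rep_eq Nil)
  next
    case (Suc k)
    have minus_1: "linear_on_group (length v) (\<lambda>g :: ('d, 'l) tensor. coeff (g - 1) v)" for v
    proof -
      have "linear_on_group (length v)
          (\<lambda>g :: ('d, 'l) tensor. coeff g v + (if v = [] then -1 else 0) * coeff g [])"
        by (intro linear_on_group_add linear_on_group_scale linear_on_group_coeff) simp_all
      then show ?thesis
        by (rule linear_on_group_cong) (simp add: minus_tensor.rep_eq one_tensor.rep_eq Nil)
    qed
    have "linear_on_group (length w) (\<lambda>g :: ('d, 'l) tensor.
        \<Sum>i\<le>length w. coeff (g - 1) (take i w) * coeff ((g - 1) ^ k) (drop i w))"
    proof (rule linear_on_group_sum)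
      fix i assume "i \<in> {..length w}"
      then show "linear_on_group (length w)
          (\<lambda>g :: ('d, 'l) tensor. coeff (g - 1) (take i w) * coeff ((g - 1) ^ k) (drop i w))"
        using linear_on_group_mult[OF minus_1[of "take i w"] Suc.IH[of "drop i w"]] Suc.prems
        by (simp add: min_absorb2)
    qed
    then show ?case
      using Suc.prems by (simp add: times_tensor.rep_eq)
  }
qed

lemma coeff_sum: "coeff (sum f I) w = (\<Sum>i\<in>I. coeff (f i) w)"
  by (induction I rule: infinite_finite_induct) (simp_all add: zero_tensor.rep_eq plus_tensor.rep_eq)

lemma linear_on_group_log_coeff:
  fixes w :: "'d::finite list"
  assumes "length w \<le> CARD('l::finite)"
  shows "linear_on_group (length w) (\<lambda>g :: ('d, 'l) tensor. coeff (tensor_log g) w)"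
proof -
  have "linear_on_group (length w) (\<lambda>g :: ('d, 'l) tensor.
      \<Sum>n\<le>CARD('l). fps_nth (fps_ln 1) n * coeff ((g - 1) ^ n) w)"
    by (intro linear_on_group_sum linear_on_group_scale linear_on_group_power_coeff assms)
  then show ?thesis
    by (rule linear_on_group_cong)
      (simp add: tensor_log_eq_power_series[OF group_vanishes_below] power_series_at_def coeff_sum
        scaleR_tensor.rep_eq)
qed

text \<open>The classical map of this kind is the first Eulerian idempotent. Only words of length at most
  \<open>length w\<close> enter its coefficient at \<open>w\<close>, so it respects the filtration.\<close>

lemma log_extends_linearly:
  obtains \<pi> :: "('d::finite, 'l::finite) tensor \<Rightarrow> ('d, 'l) tensor"
  where "linear \<pi>" "\<And>k x. vanishes_below k x \<Longrightarrow> vanishes_below k (\<pi> x)"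
    "\<And>g. g \<in> free_nilpotent_group \<Longrightarrow> \<pi> g = tensor_log g"
proof -
  have "\<forall>w. \<exists>c. length w \<le> CARD('l) \<longrightarrow> (\<forall>g\<in>free_nilpotent_group :: ('d, 'l) tensor set.
      coeff (tensor_log g) w = (\<Sum>v | length v \<le> length w. c v * coeff g v))"
    using linear_on_group_log_coeff[where 'd = 'd and 'l = 'l]
    by (simp add: linear_on_group_def)
  from choice[OF this] obtain c where c: "\<And>w g. length w \<le> CARD('l) \<Longrightarrow> g \<in> free_nilpotent_group \<Longrightarrow>
      coeff (tensor_log (g :: ('d, 'l) tensor)) w = (\<Sum>v | length v \<le> length w. c w v * coeff g v)"
    by auto
  define \<pi> :: "('d, 'l) tensor \<Rightarrow> ('d, 'l) tensor" where "\<pi> x = Abs_tensor (\<lambda>w.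
    if length w \<le> CARD('l) then \<Sum>v | length v \<le> length w. c w v * coeff x v else 0)" for x
  have coeff_\<pi>: "coeff (\<pi> x) w =
      (if length w \<le> CARD('l) then \<Sum>v | length v \<le> length w. c w v * coeff x v else 0)" for x w
    unfolding \<pi>_def by (subst Abs_tensor_inverse) auto
  show thesis
  proof (rule that)
    show "linear \<pi>"
      by (rule linearI; rule tensor_eqI)
        (simp_all add: coeff_\<pi> plus_tensor.rep_eq scaleR_tensor.rep_eq distrib_left sum.distrib
          sum_distrib_left ac_simps)
    show "vanishes_below k (\<pi> x)" if "vanishes_below k x" for k x
      using that by (auto simp: vanishes_below_def coeff_\<pi> intro!: sum.neutral)
    show "\<pi> g = tensor_log g" if "g \<in> free_nilpotent_group" for g
      by (rule tensor_eqI) (simp add: coeff_\<pi> c[OF _ that] coeff_long)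
  qed
qed

section \<open>Existence and uniqueness of the group mean\<close>

lemma free_nilpotent_group_exp: "z \<in> \<gg> \<Longrightarrow> tensor_exp z \<in> free_nilpotent_group"
  unfolding free_nilpotent_group_def by blast

lemma group_inverse_exp:
  fixes z :: "('d::finite, 'l::finite) tensor"
  assumes "z \<in> \<gg>"
  shows "group_inverse (tensor_exp (- z)) = tensor_exp z"
  unfolding group_inverse_def
proof (rule the_equality)
  note inv = tensor_exp_uminus_mult[OF free_lie_vanishes_below[OF assms]]
    tensor_exp_uminus_mult_left[OF free_lie_vanishes_below[OF assms]]
  then show "tensor_exp z \<in> free_nilpotent_group \<and> tensor_exp (- z) * tensor_exp z = 1
      \<and> tensor_exp z * tensor_exp (- z) = 1"
    using assms by (simp add: free_nilpotent_group_exp)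
  show "h = tensor_exp z" if "h \<in> free_nilpotent_group \<and> tensor_exp (- z) * h = 1
      \<and> h * tensor_exp (- z) = 1" for h
    using that inv by (metis mult.assoc mult_1_left mult_1_right)
qed

text \<open>A subspace of a Euclidean space is the intersection of kernels of inner products, which commute with the
  integral.\<close>

lemma integral_mem_subspace:
  fixes f :: "'a \<Rightarrow> 'b::euclidean_space"
  assumes "subspace S" "integrable M f" "\<And>x. x \<in> space M \<Longrightarrow> f x \<in> S"
  shows "integral\<^sup>L M f \<in> S"
proof -
  have "inner (integral\<^sup>L M f) y = 0" if "y \<in> orthogonal_comp S" for y
  proof -
    have "inner (integral\<^sup>L M f) y = (\<integral>x. inner (f x) y \<partial>M)"
      using assms(2) by simp
    also have "\<dots> = (\<integral>x. 0 \<partial>M)"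
      using assms(3) that by (intro Bochner_Integration.integral_cong refl)
        (auto simp: orthogonal_comp_def orthogonal_def)
    finally show ?thesis by simp
  qed
  then have "integral\<^sup>L M f \<in> orthogonal_comp (orthogonal_comp S)"
    by (auto simp: orthogonal_comp_def orthogonal_def inner_commute)
  then show ?thesis by (simp add: orthogonal_comp_self[OF assms(1)])
qed

lemma has_bochner_integral_linear:
  fixes T :: "'b::euclidean_space \<Rightarrow> 'c::euclidean_space"
  assumes "integrable M f" "linear T"
  shows "has_bochner_integral M (\<lambda>x. T (f x)) (T (integral\<^sup>L M f))"
  using assms(2)
  by (intro has_bochner_integral_bounded_linear[OF _ has_bochner_integral_integrable[OF assms(1)]])
    (simp add: linear_conv_bounded_linear)

lemma vanishes_below_exp_diff:
  fixes z z' :: "('d::finite, 'l::finite) tensor"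
  assumes "vanishes_below 1 z" "vanishes_below 1 z'" "vanishes_below k (z - z')"
  shows "vanishes_below k (tensor_exp z - tensor_exp z')"
  unfolding tensor_exp_eq_sum[OF assms(1)] tensor_exp_eq_sum[OF assms(2)]
    sum_subtractf[symmetric] scaleR_diff_right[symmetric]
  by (intro vanishes_below_sum vanishes_below_scaleR vanishes_below_power_diff assms)

theorem theorem10:
  fixes \<nu> :: "('d::finite, 'l::finite) tensor measure"
  assumes "prob_space \<nu>"
    and "sets \<nu> = sets (restrict_space borel free_nilpotent_group)"
    and "integrable \<nu> (\<lambda>x. x)"
  shows "\<exists>!m. is_group_mean \<nu> m"
proof -
  interpret prob_space \<nu> by fact
  have space: "space \<nu> = free_nilpotent_group"
    using sets_eq_imp_space_eq[OF assms(2)] by (simp add: space_restrict_space)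
  obtain \<pi> :: "('d, 'l) tensor \<Rightarrow> ('d, 'l) tensor" where \<pi>: "linear \<pi>"
    "\<And>k x. vanishes_below k x \<Longrightarrow> vanishes_below k (\<pi> x)"
    "\<And>g. g \<in> free_nilpotent_group \<Longrightarrow> \<pi> g = tensor_log g"
    by (rule log_extends_linearly) (rule that)
  define E where "E = (\<integral>x. x \<partial>\<nu>)"
  note E = has_bochner_integral_linear[OF assms(3), folded E_def]

  have E1: "vanishes_below 1 (E - 1)"
  proof -
    have "linear (\<lambda>x :: ('d, 'l) tensor. coeff x [])"
      by (rule linearI) (simp_all add: plus_tensor.rep_eq scaleR_tensor.rep_eq)
    from has_bochner_integral_integral_eq[OF E[OF this]]
    have "coeff E [] = (\<integral>x. coeff x [] \<partial>\<nu>)" ..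
    also have "\<dots> = (\<integral>x. 1 \<partial>\<nu>)"
      using group_vanishes_below by (intro Bochner_Integration.integral_cong refl)
        (auto simp: space vanishes_below_def minus_tensor.rep_eq one_tensor.rep_eq)
    finally show ?thesis
      by (simp add: prob_space vanishes_below_def minus_tensor.rep_eq one_tensor.rep_eq)
  qed

  have log_integral: "has_bochner_integral \<nu> (\<lambda>x. tensor_log (tensor_exp z * x)) (\<pi> (tensor_exp z * E))"
    if "z \<in> \<gg>" for z
  proof -
    have "linear (\<lambda>x. \<pi> (tensor_exp z * x))"
      by (rule linearI) (simp_all add: distrib_left linear_add[OF \<pi>(1)] linear_scale[OF \<pi>(1)])
    from E[OF this] have "has_bochner_integral \<nu> (\<lambda>x. \<pi> (tensor_exp z * x)) (\<pi> (tensor_exp z * E))" .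
    moreover have "\<pi> (tensor_exp z * x) = tensor_log (tensor_exp z * x)" if "x \<in> space \<nu>" for x
      using that \<open>z \<in> \<gg>\<close> by (simp add: space \<pi>(3) free_nilpotent_group_mult free_nilpotent_group_exp)
    ultimately show ?thesis
      by (simp cong: has_bochner_integral_cong)
  qed

  let ?F = "\<lambda>z. z - \<pi> (tensor_exp z * E)"
  have "\<exists>!z. z \<in> \<gg> \<and> ?F z = z"
  proof (rule filtration_contraction_unique_fixpoint)
    show "0 \<in> (\<gg> :: ('d, 'l) tensor set)" by (rule subspace_0[OF subspace_free_lie])
    show "?F z \<in> \<gg>" if z: "z \<in> \<gg>" for z
    proof -
      have "tensor_log (tensor_exp z * x) \<in> \<gg>" if x: "x \<in> space \<nu>" for x
      proof -
        have "tensor_exp z * x \<in> free_nilpotent_group"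
          using x by (simp add: space z free_nilpotent_group_mult free_nilpotent_group_exp)
        then show ?thesis
          unfolding free_nilpotent_group_def
          by (auto simp: tensor_log_exp[OF free_lie_vanishes_below])
      qed
      then have "(\<integral>x. tensor_log (tensor_exp z * x) \<partial>\<nu>) \<in> \<gg>"
        using log_integral[OF z]
        by (intro integral_mem_subspace subspace_free_lie) (auto simp: has_bochner_integral_iff)
      then have "\<pi> (tensor_exp z * E) \<in> \<gg>"
        using has_bochner_integral_integral_eq[OF log_integral[OF z]] by simp
      with z show ?thesis by (rule subspace_diff[OF subspace_free_lie])
    qed
    fix k and z z' :: "('d, 'l) tensor"
    assume z: "z \<in> \<gg>" "z' \<in> \<gg>" "vanishes_below k (z - z')"
    have "\<pi> (tensor_exp z) = z" "\<pi> (tensor_exp z') = z'"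
      using z by (simp_all add: \<pi>(3) free_nilpotent_group_exp tensor_log_exp[OF free_lie_vanishes_below])
    \<comment> \<open>The increments of \<open>z\<close> cancel, because \<open>\<pi>\<close> recovers \<open>z\<close> from \<open>exp z\<close>;
        the remainder gains a degree from \<open>E - 1\<close>.\<close>
    then have "?F z - ?F z' = - \<pi> ((tensor_exp z - tensor_exp z') * (E - 1))"
      by (simp add: algebra_simps linear_diff[OF \<pi>(1)] linear_add[OF \<pi>(1)])
    moreover have "vanishes_below (k + 1) ((tensor_exp z - tensor_exp z') * (E - 1))"
      by (rule vanishes_below_mult[OF vanishes_below_exp_diff[OF free_lie_vanishes_below[OF z(1)]
            free_lie_vanishes_below[OF z(2)] z(3)] E1])
    ultimately show "vanishes_below (Suc k) (?F z - ?F z')"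
      using vanishes_below_uminus[OF \<pi>(2)] by simp
  qed
  then have ex1: "\<exists>!z. z \<in> \<gg> \<and> \<pi> (tensor_exp z * E) = 0" by simp

  have mean: "is_group_mean \<nu> (tensor_exp (- z)) \<longleftrightarrow> \<pi> (tensor_exp z * E) = 0" if "z \<in> \<gg>" for z
  proof -
    have "tensor_exp (- z) \<in> free_nilpotent_group"
      by (intro free_nilpotent_group_exp subspace_neg subspace_free_lie that)
    with log_integral[OF that] show ?thesis
      by (auto simp: is_group_mean_def group_inverse_exp[OF that] dest: has_bochner_integral_eq)
  qed
  have param: "\<exists>z\<in>\<gg>. m = tensor_exp (- z)" if m: "is_group_mean \<nu> m" for m
  proof -
    from m obtain y where "y \<in> \<gg>" "m = tensor_exp y"
      unfolding is_group_mean_def free_nilpotent_group_def by auto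
    then show ?thesis
      by (intro bexI[of _ "- y"]) (simp_all add: subspace_neg[OF subspace_free_lie])
  qed
  from ex1 obtain z where z: "z \<in> \<gg>" "\<pi> (tensor_exp z * E) = 0"
    and unique: "\<And>z'. z' \<in> \<gg> \<Longrightarrow> \<pi> (tensor_exp z' * E) = 0 \<Longrightarrow> z' = z" by auto
  show ?thesis
  proof (rule ex1I)
    show "is_group_mean \<nu> (tensor_exp (- z))" using z mean by simp
    show "m = tensor_exp (- z)" if m: "is_group_mean \<nu> m" for m
      using param[OF m] mean m unique by auto
  qed
qed

end
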